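(* Let $n \geq 6$ and $p > n$ (with $p<\infty$). Then there exists a non-zero operator $A \in S^p(L^2(\mathbb{R}^n))$ whose quantum translates are linearly dependent; that is, there exist a positive integer $k$, distinct elements $(x_1,y_1),\dots,(x_k,y_k)$ of $\mathbb{R}^{2n}$, and complex scalars $c_1,\dots,c_k$, not all zero, such that $$c_1\,(x_1,y_1)\cdot A + \dots + c_k\,(x_k,y_k)\cdot A = 0.$$
   Context: $\mathcal{H} = L^2(\mathbb{R}^n)$, and $S^p(\mathcal{H})$ denotes the $p$-th Schatten class of $\mathcal{H}$ (compact operators whose singular values form an $\ell^p$ sequence). For $x,y\in\mathbb{R}^n$, $\rho(x,y,1)$ is the unitary operator on $\mathcal{H}$ given by $$(\rho(x,y,1)\varphi)(t) = e^{\pi i (x\cdot y + 2y\cdot t)}\,\varphi(t+x).$$ Quantum translation is the action of $\mathbb{R}^{2n}$ on $S^p(\mathcal{H})$ defined by $$(x,y)\cdot A = \rho(x,y,1)\, A\, \rho(x,y,1)^{-1}.$$ *)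

theory Defs
  imports "HOL-Analysis.Analysis"
begin

section \<open>The Hilbert space of square-integrable functions\<close>

definition square_integrable :: "('a::euclidean_space \<Rightarrow> complex) \<Rightarrow> bool" where
  "square_integrable f \<longleftrightarrow>
     f \<in> borel_measurable lborel \<and> integrable lborel (\<lambda>t. (cmod (f t))\<^sup>2)"

definition L2_rel :: "('a::euclidean_space \<Rightarrow> complex) \<Rightarrow> ('a \<Rightarrow> complex) \<Rightarrow> bool" where
  "L2_rel f g \<longleftrightarrow> square_integrable f \<and> square_integrable g \<and> (AE t in lborel. f t = g t)"

lemma square_integrable_measurable [measurable_dest]:
  "square_integrable f \<Longrightarrow> f \<in> borel_measurable lborel"
  by (simp add: square_integrable_def)

lemma square_integrable_zero [simp]: "square_integrable (\<lambda>t. 0)"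
  by (simp add: square_integrable_def)

lemma square_integrable_mult_bounded:
  assumes "square_integrable f" and m: "u \<in> borel_measurable lborel" and "\<And>t. cmod (u t) \<le> B"
  shows "square_integrable (\<lambda>t. u t * f t)"
proof -
  note [measurable] = square_integrable_measurable[OF assms(1)] m
  have "integrable lborel (\<lambda>t. (cmod (u t * f t))\<^sup>2)"
  proof (rule Bochner_Integration.integrable_bound[of _ "\<lambda>t. B\<^sup>2 * (cmod (f t))\<^sup>2"])
    show "integrable lborel (\<lambda>t. B\<^sup>2 * (cmod (f t))\<^sup>2)"
      using assms(1) by (simp add: square_integrable_def)
    show "(\<lambda>t. (cmod (u t * f t))\<^sup>2) \<in> borel_measurable lborel" by measurable
    have "(cmod (u t))\<^sup>2 * (cmod (f t))\<^sup>2 \<le> B\<^sup>2 * (cmod (f t))\<^sup>2" for t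
      by (intro mult_right_mono power_mono assms(3)) auto
    then show "AE t in lborel. norm ((cmod (u t * f t))\<^sup>2) \<le> norm (B\<^sup>2 * (cmod (f t))\<^sup>2)"
      by (auto simp: norm_mult power_mult_distrib)
  qed
  then show ?thesis unfolding square_integrable_def by auto
qed

lemma square_integrable_scale:
  "square_integrable f \<Longrightarrow> square_integrable (\<lambda>t. c * f t)"
  by (rule square_integrable_mult_bounded[where B = "cmod c"]) auto

lemma square_integrable_add:
  assumes "square_integrable f" "square_integrable g"
  shows "square_integrable (\<lambda>t. f t + g t)"
proof -
  note [measurable] = assms[THEN square_integrable_measurable]
  have "integrable lborel (\<lambda>t. (cmod (f t + g t))\<^sup>2)"
  proof (rule Bochner_Integration.integrable_bound
      [of _ "\<lambda>t. 2 * (cmod (f t))\<^sup>2 + 2 * (cmod (g t))\<^sup>2"])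
    show "integrable lborel (\<lambda>t. 2 * (cmod (f t))\<^sup>2 + 2 * (cmod (g t))\<^sup>2)"
      using assms by (simp add: square_integrable_def)
    show "(\<lambda>t. (cmod (f t + g t))\<^sup>2) \<in> borel_measurable lborel" by measurable
    have "(cmod (f t + g t))\<^sup>2 \<le> 2 * (cmod (f t))\<^sup>2 + 2 * (cmod (g t))\<^sup>2" for t
    proof -
      have "(cmod (f t + g t))\<^sup>2 \<le> (cmod (f t) + cmod (g t))\<^sup>2"
        by (intro power_mono norm_triangle_ineq) auto
      also have "\<dots> \<le> 2 * (cmod (f t))\<^sup>2 + 2 * (cmod (g t))\<^sup>2"
        using sum_squares_bound[of "cmod (f t)" "cmod (g t)"] by (simp add: power2_sum)
      finally show ?thesis .
    qed
    then show "AE t in lborel. norm ((cmod (f t + g t))\<^sup>2)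
        \<le> norm (2 * (cmod (f t))\<^sup>2 + 2 * (cmod (g t))\<^sup>2)"
      by auto
  qed
  then show ?thesis unfolding square_integrable_def by auto
qed

lemma borel_measurable_cnj' [measurable]: "cnj \<in> borel_measurable borel"
  by (intro borel_measurable_continuous_onI continuous_intros)

lemma square_integrable_mult_cnj:
  assumes "square_integrable f" "square_integrable g"
  shows "integrable lborel (\<lambda>t. f t * cnj (g t))"
proof (rule Bochner_Integration.integrable_bound[of _ "\<lambda>t. (cmod (f t))\<^sup>2 + (cmod (g t))\<^sup>2"])
  note [measurable] = assms[THEN square_integrable_measurable]
  show "integrable lborel (\<lambda>t. (cmod (f t))\<^sup>2 + (cmod (g t))\<^sup>2)"
    using assms by (simp add: square_integrable_def)
  show "(\<lambda>t. f t * cnj (g t)) \<in> borel_measurable lborel" by measurable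
  have "cmod (f t) * cmod (g t) \<le> (cmod (f t))\<^sup>2 + (cmod (g t))\<^sup>2" for t
  proof -
    have "0 \<le> cmod (f t) * cmod (g t)" by simp
    moreover have "2 * (cmod (f t) * cmod (g t)) \<le> (cmod (f t))\<^sup>2 + (cmod (g t))\<^sup>2"
      using sum_squares_bound[of "cmod (f t)" "cmod (g t)"] by (simp only: mult.assoc)
    ultimately show ?thesis by linarith
  qed
  then show "AE t in lborel. norm (f t * cnj (g t)) \<le> norm ((cmod (f t))\<^sup>2 + (cmod (g t))\<^sup>2)"
    by (auto simp: norm_mult)
qed

quotient_type (overloaded) 'a L2 = "'a::euclidean_space \<Rightarrow> complex" / partial: L2_rel
proof (rule part_equivpI)
  show "\<exists>f::'a \<Rightarrow> complex. L2_rel f f"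
    by (rule exI[of _ "\<lambda>t. 0"]) (simp add: L2_rel_def)
  show "symp (L2_rel :: ('a \<Rightarrow> complex) \<Rightarrow> _)"
    by (auto intro!: sympI simp: L2_rel_def elim: AE_mp)
  show "transp (L2_rel :: ('a \<Rightarrow> complex) \<Rightarrow> _)"
    by (rule transpI) (auto simp: L2_rel_def elim!: AE_mp)
qed

instantiation L2 :: (euclidean_space) ab_group_add
begin

lift_definition zero_L2 :: "'a L2" is "\<lambda>t. 0"
  by (simp add: L2_rel_def)

lift_definition plus_L2 :: "'a L2 \<Rightarrow> 'a L2 \<Rightarrow> 'a L2" is "\<lambda>f g t. f t + g t"
  by (auto simp: L2_rel_def square_integrable_add elim!: AE_mp)

lift_definition uminus_L2 :: "'a L2 \<Rightarrow> 'a L2" is "\<lambda>f t. - f t"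
  using square_integrable_scale[of _ "-1"] by (auto simp: L2_rel_def)

definition minus_L2 :: "'a L2 \<Rightarrow> 'a L2 \<Rightarrow> 'a L2" where
  "minus_L2 \<phi> \<psi> = \<phi> + - \<psi>"

instance
proof
  fix a b c :: "'a L2"
  show "a + b + c = a + (b + c)"
    by transfer (auto simp: L2_rel_def intro!: square_integrable_add simp: add.assoc)
  show "a + b = b + a"
    by transfer (auto simp: L2_rel_def intro!: square_integrable_add simp: add.commute)
  show "0 + a = a"
    by transfer (auto simp: L2_rel_def)
  show "- a + a = 0"
    by transfer (auto simp: L2_rel_def)
  show "a - b = a + - b"
    by (simp add: minus_L2_def)
qed

end

lift_definition scaleC :: "complex \<Rightarrow> 'a::euclidean_space L2 \<Rightarrow> 'a L2" (infixr \<open>*\<^sub>C\<close> 75)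
  is "\<lambda>c f t. c * f t"
  by (auto simp: L2_rel_def square_integrable_scale elim!: AE_mp)

global_interpretation L2: vector_space "scaleC :: complex \<Rightarrow> 'a::euclidean_space L2 \<Rightarrow> 'a L2"
  defines L2_dim = L2.dim
proof
  fix a b :: complex and x y :: "'a L2"
  show "a *\<^sub>C (x + y) = a *\<^sub>C x + a *\<^sub>C y"
    by transfer (auto simp: L2_rel_def algebra_simps intro!: square_integrable_add square_integrable_scale)
  show "(a + b) *\<^sub>C x = a *\<^sub>C x + b *\<^sub>C x"
    by transfer (auto simp: L2_rel_def algebra_simps intro!: square_integrable_add square_integrable_scale)
  show "a *\<^sub>C (b *\<^sub>C x) = (a * b) *\<^sub>C x"
    by transfer (auto simp: L2_rel_def algebra_simps intro!: square_integrable_scale)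
  show "1 *\<^sub>C x = x"
    by transfer (auto simp: L2_rel_def)
qed

lift_definition cinner :: "'a::euclidean_space L2 \<Rightarrow> 'a L2 \<Rightarrow> complex"
  is "\<lambda>f g. LINT t|lborel. f t * cnj (g t)"
proof -
  fix f f' g g' :: "'a \<Rightarrow> complex"
  assume a: "L2_rel f f'" "L2_rel g g'"
  then have [measurable]: "f \<in> borel_measurable lborel" "f' \<in> borel_measurable lborel"
    "g \<in> borel_measurable lborel" "g' \<in> borel_measurable lborel"
    by (auto simp: L2_rel_def square_integrable_def)
  show "(LINT t|lborel. f t * cnj (g t)) = (LINT t|lborel. f' t * cnj (g' t))"
    by (rule integral_cong_AE) (use a in \<open>auto simp: L2_rel_def elim!: AE_mp\<close>)
qed

instantiation L2 :: (euclidean_space) real_inner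
begin

definition scaleR_L2 :: "real \<Rightarrow> 'a L2 \<Rightarrow> 'a L2" where
  "scaleR_L2 r \<phi> = complex_of_real r *\<^sub>C \<phi>"

definition inner_L2 :: "'a L2 \<Rightarrow> 'a L2 \<Rightarrow> real" where
  "inner_L2 \<phi> \<psi> = Re (cinner \<phi> \<psi>)"

definition norm_L2 :: "'a L2 \<Rightarrow> real" where
  "norm_L2 \<phi> = sqrt (inner \<phi> \<phi>)"

definition sgn_L2 :: "'a L2 \<Rightarrow> 'a L2" where
  "sgn_L2 \<phi> = inverse (norm \<phi>) *\<^sub>R \<phi>"

definition dist_L2 :: "'a L2 \<Rightarrow> 'a L2 \<Rightarrow> real" where
  "dist_L2 \<phi> \<psi> = norm (\<phi> - \<psi>)"

definition uniformity_L2 :: "('a L2 \<times> 'a L2) filter" where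
  "uniformity_L2 = (INF e\<in>{0<..}. principal {(\<phi>, \<psi>). dist \<phi> \<psi> < e})"

definition open_L2 :: "'a L2 set \<Rightarrow> bool" where
  "open_L2 U \<longleftrightarrow> (\<forall>\<phi>\<in>U. eventually (\<lambda>(\<phi>', \<psi>). \<phi>' = \<phi> \<longrightarrow> \<psi> \<in> U) uniformity)"

instance
proof
  fix x y z :: "'a L2" and r s :: real
  show "r *\<^sub>R (x + y) = r *\<^sub>R x + r *\<^sub>R y"
    by (simp add: scaleR_L2_def L2.scale_right_distrib)
  show "(r + s) *\<^sub>R x = r *\<^sub>R x + s *\<^sub>R x"
    by (simp add: scaleR_L2_def L2.scale_left_distrib)
  show "r *\<^sub>R s *\<^sub>R x = (r * s) *\<^sub>R x"
    by (simp add: scaleR_L2_def)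
  show "1 *\<^sub>R x = x"
    by (simp add: scaleR_L2_def)
  show "sgn x = inverse (norm x) *\<^sub>R x" by (rule sgn_L2_def)
  show "dist x y = norm (x - y)" by (rule dist_L2_def)
  show "(uniformity :: ('a L2 \<times> 'a L2) filter) = (INF e\<in>{0<..}. principal {(x, y). dist x y < e})"
    by (rule uniformity_L2_def)
  show "open U \<longleftrightarrow> (\<forall>x\<in>U. eventually (\<lambda>(x', y). x' = x \<longrightarrow> y \<in> U) uniformity)" for U :: "'a L2 set"
    by (rule open_L2_def)
  have "cinner x y = cnj (cinner y x)"
    by transfer (simp only: Bochner_Integration.integral_cnj[symmetric] complex_cnj_mult
        complex_cnj_cnj mult.commute)
  then show "inner x y = inner y x"
    by (simp add: inner_L2_def)
  have "cinner (x + y) z = cinner x z + cinner y z"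
    by transfer
      (simp add: L2_rel_def distrib_right Bochner_Integration.integral_add square_integrable_mult_cnj)
  then show "inner (x + y) z = inner x z + inner y z"
    by (simp add: inner_L2_def)
  have "cinner (complex_of_real r *\<^sub>C x) y = complex_of_real r * cinner x y"
    by transfer (simp add: mult.assoc)
  then show "inner (r *\<^sub>R x) y = r * inner x y"
    by (simp add: inner_L2_def scaleR_L2_def)
  have self: "cinner x x = complex_of_real (LINT t|lborel. (cmod (rep_L2 x t))\<^sup>2)"
    unfolding cinner.rep_eq complex_norm_square[symmetric] by (rule integral_complex_of_real)
  then show "0 \<le> inner x x"
    by (simp add: inner_L2_def)
  show "inner x x = 0 \<longleftrightarrow> x = 0"
    unfolding inner_L2_def
  proof transfer
    fix f :: "'a \<Rightarrow> complex"
    assume f: "L2_rel f f"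
    then have "integrable lborel (\<lambda>t. (cmod (f t))\<^sup>2)"
      by (simp add: L2_rel_def square_integrable_def)
    then have "(LINT t|lborel. (cmod (f t))\<^sup>2) = 0 \<longleftrightarrow> (AE t in lborel. f t = 0)"
      by (subst integral_nonneg_eq_0_iff_AE) auto
    moreover have "Re (LINT t|lborel. f t * cnj (f t)) = (LINT t|lborel. (cmod (f t))\<^sup>2)"
      by (simp only: complex_norm_square[symmetric] integral_complex_of_real Re_complex_of_real)
    ultimately show "Re (LINT t|lborel. f t * cnj (f t)) = 0 \<longleftrightarrow> L2_rel f (\<lambda>t. 0)"
      using f by (simp add: L2_rel_def)
  qed
  show "norm x = sqrt (inner x x)" by (rule norm_L2_def)
qed

end


section \<open>Schatten classes\<close>

abbreviation clinear_L2 :: "('a::euclidean_space L2 \<Rightarrow> 'a L2) \<Rightarrow> bool" where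
  "clinear_L2 \<equiv> Vector_Spaces.linear scaleC scaleC"

definition compact_operator :: "('a::euclidean_space L2 \<Rightarrow> 'a L2) \<Rightarrow> bool" where
  "compact_operator A \<longleftrightarrow> clinear_L2 A \<and> compact (closure (A ` cball 0 1))"

text \<open>The description is proper for every bounded linear operator, by the Riesz representation theorem.\<close>

definition cadjoint :: "('a::euclidean_space L2 \<Rightarrow> 'a L2) \<Rightarrow> 'a L2 \<Rightarrow> 'a L2" where
  "cadjoint A = (THE B. \<forall>\<phi> \<psi>. cinner (A \<phi>) \<psi> = cinner \<phi> (B \<psi>))"

definition eigenspace :: "('a::euclidean_space L2 \<Rightarrow> 'a L2) \<Rightarrow> complex \<Rightarrow> 'a L2 set" where
  "eigenspace T \<mu> = {\<phi>. T \<phi> = \<mu> *\<^sub>C \<phi>}"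

text \<open>
  The singular values of a compact operator \<open>A\<close> are the square roots of the eigenvalues of
  \<open>A\<^sup>* A\<close>, in decreasing order and repeated according to multiplicity. The sequence is padded with
  zeros when \<open>A\<close> has finite rank; otherwise all its terms are positive and the kernel of \<open>A\<close> does
  not contribute. For compact \<open>A\<close> the eigenspaces below are finite-dimensional, so the convention
  that \<open>dim\<close> is \<open>0\<close> on infinite-dimensional spaces plays no role.
\<close>

definition singular_values :: "('a::euclidean_space L2 \<Rightarrow> 'a L2) \<Rightarrow> (nat \<Rightarrow> real) \<Rightarrow> bool" where
  "singular_values A s \<longleftrightarrow>
     decseq s \<and> (\<forall>k. 0 \<le> s k) \<and>
     (\<forall>\<sigma>>0. finite {k. s k = \<sigma>} \<and>
        card {k. s k = \<sigma>} = L2_dim (eigenspace (cadjoint A \<circ> A) (complex_of_real (\<sigma>\<^sup>2))))"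

definition schatten_class :: "real \<Rightarrow> ('a::euclidean_space L2 \<Rightarrow> 'a L2) set" where
  "schatten_class p =
     {A. compact_operator A \<and> (\<exists>s. singular_values A s \<and> summable (\<lambda>k. s k powr p))}"


section \<open>Quantum translation\<close>

lemma AE_lborel_translate:
  fixes x :: "'a::euclidean_space"
  assumes "AE t in lborel. P t"
  shows "AE t in lborel. P (t + x)"
proof -
  have "AE t in distr lborel borel ((+) x). P t"
    using assms by (subst lborel_distr_plus)
  then have "AE t in lborel. P (x + t)"
    by (rule AE_distrD[rotated]) simp
  then show ?thesis by (simp add: add.commute)
qed

lemma square_integrable_translate:
  assumes "square_integrable f"
  shows "square_integrable (\<lambda>t. f (t + x))"
proof -
  have [measurable]: "f \<in> borel_measurable borel"
    using assms by (simp add: square_integrable_def)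
  have "integrable (distr lborel borel ((+) x)) (\<lambda>t. (cmod (f t))\<^sup>2)"
    using assms by (subst lborel_distr_plus) (simp add: square_integrable_def)
  then have "integrable lborel (\<lambda>t. (cmod (f (x + t)))\<^sup>2)"
    by (rule integrable_distr[rotated]) simp
  then show ?thesis
    by (simp add: square_integrable_def add.commute)
qed

text \<open>\<open>rho x y\<close> is the operator $\rho(x,y,1)$.\<close>

lift_definition rho :: "'a::euclidean_space \<Rightarrow> 'a \<Rightarrow> 'a L2 \<Rightarrow> 'a L2"
  is "\<lambda>x y f t. exp (complex_of_real pi * \<i> * complex_of_real (x \<bullet> y + 2 * (y \<bullet> t))) * f (t + x)"
proof -
  fix x y :: 'a and f g :: "'a \<Rightarrow> complex"
  let ?u = "\<lambda>t. exp (complex_of_real pi * \<i> * complex_of_real (x \<bullet> y + 2 * (y \<bullet> t)))"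
  assume "L2_rel f g"
  moreover have "square_integrable (\<lambda>t. ?u t * h (t + x))" if "square_integrable h" for h
  proof (rule square_integrable_mult_bounded[OF square_integrable_translate[OF that]])
    show "?u \<in> borel_measurable lborel" by measurable
    show "cmod (?u t) \<le> 1" for t by simp
  qed
  ultimately show "L2_rel (\<lambda>t. ?u t * f (t + x)) (\<lambda>t. ?u t * g (t + x))"
    by (auto simp: L2_rel_def dest!: AE_lborel_translate[of _ x] elim!: AE_mp)
qed

lemma rho_rho_minus: "rho x y (rho (- x) (- y) \<phi>) = \<phi>"
proof transfer
  fix x y :: 'a and f :: "'a \<Rightarrow> complex"
  have "exp (complex_of_real pi * \<i> * complex_of_real (x \<bullet> y + 2 * (y \<bullet> t))) *
      (exp (complex_of_real pi * \<i> * complex_of_real (- x \<bullet> - y + 2 * (- y \<bullet> (t + x)))) *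
        f (t + x + - x)) = f t" (is "exp (?q * of_real ?a) * (exp (?q * of_real ?b) * _) = _") for t
  proof -
    have "?b = - ?a"
      by (simp add: inner_commute[of x y] inner_add_right)
    then have "exp (?q * of_real ?a) * exp (?q * of_real ?b) = 1"
      by (simp only: of_real_minus mult_minus_right exp_minus_inverse)
    then show ?thesis
      by (simp only: mult.assoc[symmetric]) simp
  qed
  moreover assume "L2_rel f f"
  ultimately show "L2_rel (\<lambda>t. exp (complex_of_real pi * \<i> * complex_of_real (x \<bullet> y + 2 * (y \<bullet> t))) *
      (exp (complex_of_real pi * \<i> * complex_of_real (- x \<bullet> - y + 2 * (- y \<bullet> (t + x)))) *
        f (t + x + - x))) f"
    by presburger
qed

lemma bij_rho: "bij (rho x y)"
  using rho_rho_minus[of x y] rho_rho_minus[of "- x" "- y"]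
  by (intro bijI') (metis minus_minus)+

definition quantum_translate ::
  "'a::euclidean_space \<times> 'a \<Rightarrow> ('a L2 \<Rightarrow> 'a L2) \<Rightarrow> 'a L2 \<Rightarrow> 'a L2" where
  "quantum_translate z A = (case z of (x, y) \<Rightarrow> rho x y \<circ> A \<circ> inv (rho x y))"

end

theory Submission
  imports Defs
begin

text \<open>
  The operator is diagonal. Let \<open>v\<close>, \<open>w\<close> be two coordinate vectors and let
  \<open>e\<^sub>k\<^sub>m\<close> be the indicator function of the open unit cube, evaluated at \<open>t + k v + m w\<close> for
  integers \<open>k\<close>, \<open>m\<close>. These functions have disjoint supports, hence are orthonormal. Put
  \<open>A \<phi> = (\<Sum>k m. f (k, m) \<langle>\<phi>, e\<^sub>k\<^sub>m\<rangle> e\<^sub>k\<^sub>m)\<close>. Translation by \<open>a v + b w\<close> permutes the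
  \<open>e\<^sub>k\<^sub>m\<close>, so the corresponding quantum translate of \<open>A\<close> is again diagonal, with \<open>f\<close> shifted by
  \<open>(a, b)\<close> (\<open>quantum_translate_diag\<close>). The singular values of \<open>A\<close> are the \<open>\<bar>f (k, m)\<bar>\<close> in decreasing
  order, so that \<open>A\<close> lies in the Schatten class as soon as \<open>f\<close> is in \<open>\<ell>\<^sup>p\<close>
  (\<open>diag_in_schatten_class\<close>). It remains to find a non-zero \<open>f\<close> in \<open>\<ell>\<^sup>p(\<int>\<^sup>2)\<close>
  that satisfies a linear difference equation with constant coefficients.

  Such an \<open>f\<close> is given by the Fourier coefficients of a measure on a curve in the torus on which a
  trigonometric polynomial vanishes. The curve used here consists of the points
  \<open>z = (1 + iu) / (1 - iu)\<close>, \<open>w = (1 + iu\<^sup>2) / (1 - iu\<^sup>2)\<close>: since \<open>u\<close> is a rational function of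
  \<open>z\<close>, the coordinates satisfy a polynomial equation, which has six terms (\<open>curve_relation\<close>), and this
  equation becomes a six-term difference equation for \<open>f\<close> (\<open>curve_coeff_relation\<close>).

  The chosen arc has non-vanishing curvature, so by van der Corput's method \<open>\<bar>f (k, m)\<bar>\<close> is at most a
  constant times \<open>(1 + \<bar>k\<bar> + \<bar>m\<bar>)\<^bsup>-1/2\<^esup>\<close> (\<open>curve_coeff_decay\<close>). For \<open>p > 6\<close> the \<open>p\<close>-th powers are
  dominated by \<open>(1 + \<bar>k\<bar> + \<bar>m\<bar>)\<^bsup>-3\<^esup>\<close>, which is summable over the plane lattice.
\<close>

section \<open>The inner product of square-integrable functions\<close>

lemma cinner_commute: "cinner x y = cnj (cinner y x)"
  by transfer (simp only: Bochner_Integration.integral_cnj[symmetric] complex_cnj_mult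
      complex_cnj_cnj mult.commute)

lemma cinner_add_left: "cinner (x + y) z = cinner x z + cinner y z"
  by transfer
    (simp add: L2_rel_def distrib_right Bochner_Integration.integral_add square_integrable_mult_cnj)

lemma cinner_scaleC_left: "cinner (c *\<^sub>C x) y = c * cinner x y"
  by transfer (simp add: mult.assoc)

lemma cinner_add_right: "cinner z (x + y) = cinner z x + cinner z y"
  by (metis cinner_add_left cinner_commute complex_cnj_add)

lemma cinner_scaleC_right: "cinner y (c *\<^sub>C x) = cnj c * cinner y x"
  by (metis cinner_scaleC_left cinner_commute complex_cnj_mult)

lemma scaleR_conv_scaleC: "r *\<^sub>R x = complex_of_real r *\<^sub>C (x :: 'a::euclidean_space L2)"
  by (rule scaleR_L2_def)

lemma cinner_self: "cinner x x = complex_of_real ((norm x)\<^sup>2)"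
proof -
  have "Im (cinner x x) = 0"
    using arg_cong[of _ _ Im, OF cinner_commute[of x x]] by simp
  moreover have "Re (cinner x x) = (norm x)\<^sup>2"
    by (simp add: power2_norm_eq_inner inner_L2_def)
  ultimately show ?thesis by (simp add: complex_eq_iff)
qed

lemma norm_scaleC: "norm (c *\<^sub>C x) = cmod c * norm x"
proof -
  have "complex_of_real ((norm (c *\<^sub>C x))\<^sup>2) = complex_of_real ((cmod c * norm x)\<^sup>2)"
    unfolding cinner_self[symmetric] cinner_scaleC_left cinner_scaleC_right
    by (simp add: cinner_self power_mult_distrib complex_norm_square[unfolded of_real_power] mult_ac)
  then have "(norm (c *\<^sub>C x))\<^sup>2 = (cmod c * norm x)\<^sup>2"
    using of_real_eq_iff by blast
  then show ?thesis by simp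
qed

lemma norm_cinner_le: "cmod (cinner x y) \<le> norm x * norm y"
proof -
  obtain u where u: "cmod u = 1" "u * cinner x y = complex_of_real (cmod (cinner x y))"
  proof (cases "cinner x y = 0")
    case True
    then show ?thesis using that[of 1] by simp
  next
    case False
    then show ?thesis
      using that[of "cnj (cinner x y) / cmod (cinner x y)"]
      by (simp add: norm_divide complex_norm_square[symmetric] mult.commute power2_eq_square field_simps)
  qed
  have "cmod (cinner x y) = inner (u *\<^sub>C x) y"
    by (simp add: inner_L2_def cinner_scaleC_left u)
  also have "\<dots> \<le> norm (u *\<^sub>C x) * norm y" by (rule norm_cauchy_schwarz)
  finally show ?thesis by (simp add: norm_scaleC u)
qed

lemma bounded_linear_cinner_left: "bounded_linear (\<lambda>x. cinner x y)"
  by (rule bounded_linear_intro[where K = "norm y"])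
    (simp_all add: cinner_add_left scaleR_conv_scaleC cinner_scaleC_left norm_cinner_le scaleR_conv_of_real)

lemma bounded_linear_scaleC_right:
  "bounded_linear (\<lambda>x :: 'a::euclidean_space L2. c *\<^sub>C x)"
  by (rule bounded_linear_intro[where K = "cmod c"])
    (simp_all add: L2.scale_right_distrib scaleR_conv_scaleC norm_scaleC mult.commute)

lemma bounded_linear_scaleC_left: "bounded_linear (\<lambda>c. c *\<^sub>C (x :: 'a::euclidean_space L2))"
  by (rule bounded_linear_intro[where K = "norm x"])
    (simp_all add: L2.scale_left_distrib scaleR_conv_scaleC norm_scaleC scaleR_conv_of_real)

lemma cinner_sum_left: "cinner (\<Sum>i\<in>F. f i) y = (\<Sum>i\<in>F. cinner (f i) y)"
  by (rule linear_sum[OF bounded_linear.linear[OF bounded_linear_cinner_left]])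

lemma cinner_sum_right: "cinner y (\<Sum>i\<in>F. f i) = (\<Sum>i\<in>F. cinner y (f i))"
  by (subst cinner_commute) (simp add: cinner_sum_left cinner_commute[of y])

lemma cinner_ext: "(\<And>\<phi>. cinner \<phi> x = cinner \<phi> y) \<Longrightarrow> x = y"
proof -
  assume *: "\<And>\<phi>. cinner \<phi> x = cinner \<phi> y"
  have "cinner (x - y) (x - y) = cinner (x - y) x - cinner (x - y) y"
    by (metis add_diff_cancel_right' cinner_add_right diff_add_cancel)
  then have "norm (x - y) = 0" using *[of "x - y"] by (simp add: cinner_self)
  then show ?thesis by simp
qed

section \<open>The unitary operators of the Heisenberg group\<close>

lemma rho_add: "rho x y (\<phi> + \<psi>) = rho x y \<phi> + rho x y \<psi>"
proof transfer
  fix x y :: 'a and f g :: "'a \<Rightarrow> complex"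
  assume "L2_rel f f" "L2_rel g g"
  then have 1: "square_integrable (\<lambda>t. f t + g t)" by (auto simp: L2_rel_def square_integrable_add)
  have "square_integrable (\<lambda>t. exp (complex_of_real pi * \<i> * complex_of_real (x \<bullet> y + 2 * (y \<bullet> t))) * (f (t+x) + g (t+x)))"
    by (rule square_integrable_mult_bounded[OF square_integrable_translate[OF 1], where B = 1]) simp_all
  then show "L2_rel
        (\<lambda>t. exp (complex_of_real pi * \<i> * complex_of_real (x \<bullet> y + 2 * (y \<bullet> t))) * (f (t + x) + g (t + x)))
        (\<lambda>t. exp (complex_of_real pi * \<i> * complex_of_real (x \<bullet> y + 2 * (y \<bullet> t))) * f (t + x) +
             exp (complex_of_real pi * \<i> * complex_of_real (x \<bullet> y + 2 * (y \<bullet> t))) * g (t + x))"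
    by (simp add: L2_rel_def distrib_left)
qed

lemma rho_scaleC: "rho x y (c *\<^sub>C \<phi>) = c *\<^sub>C rho x y \<phi>"
proof transfer
  fix x y :: 'a and f :: "'a \<Rightarrow> complex" and c
  assume "L2_rel f f"
  then have 1: "square_integrable (\<lambda>t. c * f t)" by (auto simp: L2_rel_def square_integrable_scale)
  have "square_integrable (\<lambda>t. exp (complex_of_real pi * \<i> * complex_of_real (x \<bullet> y + 2 * (y \<bullet> t))) * (c * f (t+x)))"
    by (rule square_integrable_mult_bounded[OF square_integrable_translate[OF 1], where B = 1]) simp_all
  then show "L2_rel
        (\<lambda>t. exp (complex_of_real pi * \<i> * complex_of_real (x \<bullet> y + 2 * (y \<bullet> t))) * (c * f (t + x)))
        (\<lambda>t. c * (exp (complex_of_real pi * \<i> * complex_of_real (x \<bullet> y + 2 * (y \<bullet> t))) * f (t + x)))"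
    by (simp add: L2_rel_def mult.left_commute)
qed

lemma cinner_rho: "cinner (rho x y \<phi>) (rho x y \<psi>) = cinner \<phi> \<psi>"
proof transfer
  fix x y :: 'a and f g :: "'a \<Rightarrow> complex"
  assume fg: "L2_rel f f" "L2_rel g g"
  let ?E = "\<lambda>t. exp (complex_of_real pi * \<i> * complex_of_real (x \<bullet> y + 2 * (y \<bullet> t)))"
  have [measurable]: "f \<in> borel_measurable borel" "g \<in> borel_measurable borel"
    using fg by (auto simp: L2_rel_def square_integrable_def)
  have unit: "z * u * cnj (z * v) = u * cnj v" if "cmod z = 1" for z u v
  proof -
    have "z * u * cnj (z * v) = (z * cnj z) * (u * cnj v)" by (simp add: mult.assoc mult.left_commute)
    then show ?thesis using that by (simp add: complex_norm_square[symmetric])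
  qed
  have "?E t * f (t + x) * cnj (?E t * g (t + x)) = f (x + t) * cnj (g (x + t))" for t
    by (subst unit) (simp_all add: add.commute)
  then have "(LINT t|lborel. ?E t * f (t + x) * cnj (?E t * g (t + x)))
      = (LINT t|lborel. f (x + t) * cnj (g (x + t)))"
    by presburger
  also have "\<dots> = (LINT t|distr lborel borel ((+) x). f t * cnj (g t))"
    by (rule integral_distr[symmetric]) measurable
  finally show "(LINT t|lborel. ?E t * f (t + x) * cnj (?E t * g (t + x)))
      = (LINT t|lborel. f t * cnj (g t))"
    by (simp add: lborel_distr_plus)
qed

lemma norm_rho: "norm (rho x y \<phi>) = norm \<phi>"
  using cinner_rho[of x y \<phi> \<phi>] unfolding cinner_self of_real_eq_iff by simp

lemma bounded_linear_rho: "bounded_linear (rho x y)"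
  by (rule bounded_linear_intro[where K = 1])
    (simp_all add: rho_add scaleR_conv_scaleC rho_scaleC norm_rho)

lemma inv_rho: "inv (rho x y) = rho (- x) (- y)"
  using rho_rho_minus[of "x" "y"] bij_rho[of x y]
  by (intro ext) (metis bij_inv_eq_iff)

section \<open>Diagonal operators\<close>

lemma has_sum_finite_support:
  assumes "finite S" "\<And>i. i \<notin> S \<Longrightarrow> f i = 0"
  shows "(f has_sum sum f S) UNIV"
  by (rule has_sum_cong_neutral[THEN iffD1, OF _ _ _ has_sum_finite[OF assms(1)]]) (use assms in auto)

text \<open>
  The second condition holds for every orthonormal family in a complete space. As an assumption it
  makes the theory of diagonal operators independent of the completeness of \<open>L\<^sup>2\<close>; for the family
  needed below it can be checked by hand, because the supports are disjoint.
\<close>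

locale riesz_fischer_family =
  fixes e :: "'i::countable \<Rightarrow> 'a::euclidean_space L2"
  assumes orthonormal: "cinner (e i) (e j) = of_bool (i = j)"
    and riesz_fischer: "(\<lambda>i. (cmod (c i))\<^sup>2) summable_on UNIV \<Longrightarrow> (\<lambda>i. c i *\<^sub>C e i) summable_on UNIV"
begin

lemma cinner_finite_sum:
  assumes "finite F" shows "cinner (\<Sum>i\<in>F. c i *\<^sub>C e i) (e j) = (if j \<in> F then c j else 0)"
proof -
  have "cinner (\<Sum>i\<in>F. c i *\<^sub>C e i) (e j) = (\<Sum>i\<in>F. if i = j then c i else 0)"
    unfolding cinner_sum_left cinner_scaleC_left orthonormal by (rule sum.cong) auto
  then show ?thesis using assms by (simp add: sum.delta)
qed

lemma norm_finite_sum: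
  assumes "finite F" shows "(norm (\<Sum>i\<in>F. c i *\<^sub>C e i))\<^sup>2 = (\<Sum>i\<in>F. (cmod (c i))\<^sup>2)"
proof -
  have "complex_of_real ((norm (\<Sum>i\<in>F. c i *\<^sub>C e i))\<^sup>2) = (\<Sum>j\<in>F. cnj (c j) * c j)"
    unfolding cinner_self[symmetric]
    by (subst cinner_sum_right) (simp add: cinner_scaleC_right cinner_finite_sum[OF assms])
  also have "\<dots> = complex_of_real (\<Sum>i\<in>F. (cmod (c i))\<^sup>2)"
    by (simp add: complex_norm_square[unfolded of_real_power] mult.commute)
  finally show ?thesis using of_real_eq_iff by blast
qed

lemma bessel:
  assumes "finite F" shows "(\<Sum>i\<in>F. (cmod (cinner \<phi> (e i)))\<^sup>2) \<le> (norm \<phi>)\<^sup>2"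
proof -
  define P where "P = (\<Sum>i\<in>F. cinner \<phi> (e i) *\<^sub>C e i)"
  have "cinner \<phi> P = cinner P P"
    unfolding P_def cinner_sum_right cinner_scaleC_right using cinner_finite_sum[OF assms] by simp
  then have "inner \<phi> P = (norm P)\<^sup>2"
    by (simp add: inner_L2_def cinner_self)
  then have "(norm \<phi>)\<^sup>2 = (norm P)\<^sup>2 + (norm (\<phi> - P))\<^sup>2"
    by (simp add: power2_norm_eq_inner inner_diff_left inner_diff_right inner_commute)
  then show ?thesis using norm_finite_sum[OF assms, of "\<lambda>i. cinner \<phi> (e i)"] by (simp add: P_def)
qed

lemma norm_has_sum_le:
  assumes sum: "((\<lambda>i. c i *\<^sub>C e i) has_sum \<phi>) S"
    and bound: "\<And>F. finite F \<Longrightarrow> F \<subseteq> S \<Longrightarrow> (\<Sum>i\<in>F. (cmod (c i))\<^sup>2) \<le> M\<^sup>2" and "0 \<le> M"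
  shows "norm \<phi> \<le> M"
proof (rule tendsto_upperbound[OF tendsto_norm[OF sum[unfolded has_sum_def]]])
  show "\<forall>\<^sub>F F in finite_subsets_at_top S. norm (\<Sum>i\<in>F. c i *\<^sub>C e i) \<le> M"
  proof (rule eventually_finite_subsets_at_top_weakI)
    fix F assume "finite F" "F \<subseteq> S"
    then have "(norm (\<Sum>i\<in>F. c i *\<^sub>C e i))\<^sup>2 \<le> M\<^sup>2" using bound norm_finite_sum by simp
    then show "norm (\<Sum>i\<in>F. c i *\<^sub>C e i) \<le> M" using \<open>0 \<le> M\<close> by (rule power2_le_imp_le)
  qed
qed simp

text \<open>
  The unit ball of \<open>\<ell>\<^sup>2\<close>, regarded as a subset of the space of all families with the
  topology of pointwise convergence. It is compact there by Tychonoff's theorem, which replaces weak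
  compactness of the unit ball of the Hilbert space.
\<close>

definition coeff_ball :: "('i \<Rightarrow> complex) set" where
  "coeff_ball = {c. \<forall>F. finite F \<longrightarrow> (\<Sum>i\<in>F. (cmod (c i))\<^sup>2) \<le> 1}"

lemma compact_coeff_ball: "compact coeff_ball"
proof -
  have "compactin (product_topology (\<lambda>i::'i. euclidean) UNIV) (PiE UNIV (\<lambda>i. cball (0::complex) 1))"
    by (subst compactin_PiE) simp
  then have c: "compact (PiE UNIV (\<lambda>i::'i. cball (0::complex) 1))"
    by (simp add: euclidean_product_topology)
  have "closed (\<Inter>F\<in>{F. finite F}. {c::'i \<Rightarrow> complex. (\<Sum>i\<in>F. (cmod (c i))\<^sup>2) \<le> 1})"
    by (intro closed_INT ballI closed_Collect_le continuous_intros continuous_on_product_coordinates)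
  also have "(\<Inter>F\<in>{F. finite F}. {c::'i \<Rightarrow> complex. (\<Sum>i\<in>F. (cmod (c i))\<^sup>2) \<le> 1}) = coeff_ball"
    by (auto simp: coeff_ball_def)
  finally have "compact (PiE UNIV (\<lambda>i::'i. cball (0::complex) 1) \<inter> coeff_ball)"
    using c by (rule compact_Int_closed[rotated])
  moreover have "coeff_ball \<subseteq> PiE UNIV (\<lambda>i::'i. cball (0::complex) 1)"
  proof
    fix c :: "'i \<Rightarrow> complex" assume c: "c \<in> coeff_ball"
    have "(cmod (c i))\<^sup>2 \<le> 1\<^sup>2" for i
      using c[unfolded coeff_ball_def, simplified, rule_format, of "{i}"] by simp
    then have "cmod (c i) \<le> 1" for i by (rule power2_le_imp_le) simp
    then show "c \<in> PiE UNIV (\<lambda>i::'i. cball (0::complex) 1)" by (auto simp: PiE_iff)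
  qed
  ultimately show ?thesis by (simp add: Int_absorb1)
qed

definition diag :: "('i \<Rightarrow> complex) \<Rightarrow> 'a L2 \<Rightarrow> 'a L2" where
  "diag \<gamma> \<phi> = (\<Sum>\<^sub>\<infinity>i. (\<gamma> i * cinner \<phi> (e i)) *\<^sub>C e i)"

lemma summable_weighted:
  assumes \<gamma>: "\<And>i. cmod (\<gamma> i) \<le> K" and c: "\<And>F. finite F \<Longrightarrow> (\<Sum>i\<in>F. (cmod (c i))\<^sup>2) \<le> M"
  shows "(\<lambda>i. (\<gamma> i * c i) *\<^sub>C e i) summable_on UNIV"
proof (rule riesz_fischer, rule nonneg_bdd_above_summable_on)
  show "bdd_above (sum (\<lambda>i. (cmod (\<gamma> i * c i))\<^sup>2) ` {F. F \<subseteq> UNIV \<and> finite F})"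
  proof (rule bdd_aboveI2)
    fix F :: "'i set" assume "F \<in> {F. F \<subseteq> UNIV \<and> finite F}"
    then have F: "finite F" by simp
    have "(\<Sum>i\<in>F. (cmod (\<gamma> i * c i))\<^sup>2) \<le> (\<Sum>i\<in>F. K\<^sup>2 * (cmod (c i))\<^sup>2)"
      by (rule sum_mono)
        (auto simp: norm_mult power_mult_distrib intro!: mult_right_mono power_mono \<gamma>)
    also have "\<dots> \<le> K\<^sup>2 * M"
      unfolding sum_distrib_left[symmetric] by (intro mult_left_mono c F) simp
    finally show "(\<Sum>i\<in>F. (cmod (\<gamma> i * c i))\<^sup>2) \<le> K\<^sup>2 * M" .
  qed
qed simp

lemma has_sum_diag:
  assumes "\<And>i. cmod (\<gamma> i) \<le> K"
  shows "((\<lambda>i. (\<gamma> i * cinner \<phi> (e i)) *\<^sub>C e i) has_sum diag \<gamma> \<phi>) UNIV"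
  unfolding diag_def
  by (rule has_sum_infsum, rule summable_weighted[where M = "(norm \<phi>)\<^sup>2"])
    (rule assms bessel, assumption?)+

lemma cinner_has_sum:
  assumes "((\<lambda>i. c i *\<^sub>C e i) has_sum \<phi>) UNIV"
  shows "cinner \<phi> (e j) = c j"
proof -
  have "((\<lambda>i. cinner (c i *\<^sub>C e i) (e j)) has_sum cinner \<phi> (e j)) UNIV"
    using assms by (rule has_sum_bounded_linear[OF bounded_linear_cinner_left])
  moreover have "((\<lambda>i. cinner (c i *\<^sub>C e i) (e j)) has_sum (\<Sum>i\<in>{j}. cinner (c i *\<^sub>C e i) (e j))) UNIV"
    by (rule has_sum_finite_support) (auto simp: cinner_scaleC_left orthonormal)
  ultimately show ?thesis
    using has_sum_unique by (fastforce simp: cinner_scaleC_left orthonormal)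
qed

context
  fixes \<gamma> :: "'i \<Rightarrow> complex" and K :: real
  assumes bounded: "\<And>i. cmod (\<gamma> i) \<le> K"
begin

lemma cinner_diag: "cinner (diag \<gamma> \<phi>) (e j) = \<gamma> j * cinner \<phi> (e j)"
  by (rule cinner_has_sum[OF has_sum_diag[OF bounded]])

lemma linear_diag: "clinear_L2 (diag \<gamma>)"
  unfolding Vector_Spaces.linear_iff
proof (intro conjI allI)
  fix \<phi> \<psi> :: "'a L2" and r
  have "((\<lambda>i. (\<gamma> i * cinner \<phi> (e i)) *\<^sub>C e i + (\<gamma> i * cinner \<psi> (e i)) *\<^sub>C e i)
      has_sum (diag \<gamma> \<phi> + diag \<gamma> \<psi>)) UNIV"
    by (intro has_sum_add has_sum_diag[OF bounded])
  then show "diag \<gamma> (\<phi> + \<psi>) = diag \<gamma> \<phi> + diag \<gamma> \<psi>"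
    by (intro has_sum_unique[OF has_sum_diag[OF bounded]])
      (simp add: cinner_add_left L2.scale_left_distrib[symmetric] distrib_left)
  have "((\<lambda>i. r *\<^sub>C ((\<gamma> i * cinner \<phi> (e i)) *\<^sub>C e i)) has_sum (r *\<^sub>C diag \<gamma> \<phi>)) UNIV"
    by (intro has_sum_bounded_linear[OF bounded_linear_scaleC_right] has_sum_diag[OF bounded])
  then show "diag \<gamma> (r *\<^sub>C \<phi>) = r *\<^sub>C diag \<gamma> \<phi>"
    by (intro has_sum_unique[OF has_sum_diag[OF bounded]])
      (simp add: cinner_scaleC_left mult.left_commute)
qed (rule L2.vector_space_axioms)+

lemma cinner_diag_left: "cinner (diag \<gamma> \<phi>) \<psi> = cinner \<phi> (diag (\<lambda>i. cnj (\<gamma> i)) \<psi>)"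
proof -
  have b: "cmod (cnj (\<gamma> i)) \<le> K" for i using bounded by simp
  have 1: "((\<lambda>i. cinner ((\<gamma> i * cinner \<phi> (e i)) *\<^sub>C e i) \<psi>) has_sum cinner (diag \<gamma> \<phi>) \<psi>) UNIV"
    by (rule has_sum_bounded_linear[OF bounded_linear_cinner_left has_sum_diag[OF bounded]])
  have "((\<lambda>i. cinner ((cnj (\<gamma> i) * cinner \<psi> (e i)) *\<^sub>C e i) \<phi>) has_sum
      cinner (diag (\<lambda>i. cnj (\<gamma> i)) \<psi>) \<phi>) UNIV"
    by (rule has_sum_bounded_linear[OF bounded_linear_cinner_left has_sum_diag[OF b]])
  then have "((\<lambda>i. cnj (cinner ((cnj (\<gamma> i) * cinner \<psi> (e i)) *\<^sub>C e i) \<phi>)) has_sum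
      cnj (cinner (diag (\<lambda>i. cnj (\<gamma> i)) \<psi>) \<phi>)) UNIV"
    by (simp only: has_sum_cnj_iff)
  moreover have "cnj (cinner ((cnj (\<gamma> i) * cinner \<psi> (e i)) *\<^sub>C e i) \<phi>)
      = cinner ((\<gamma> i * cinner \<phi> (e i)) *\<^sub>C e i) \<psi>" for i
    using cinner_commute[of \<phi> "e i"] cinner_commute[of "e i" \<psi>] by (simp add: cinner_scaleC_left)
  ultimately have "((\<lambda>i. cinner ((\<gamma> i * cinner \<phi> (e i)) *\<^sub>C e i) \<psi>) has_sum
      cnj (cinner (diag (\<lambda>i. cnj (\<gamma> i)) \<psi>) \<phi>)) UNIV" by simp
  then have "cinner (diag \<gamma> \<phi>) \<psi> = cnj (cinner (diag (\<lambda>i. cnj (\<gamma> i)) \<psi>) \<phi>)"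
    by (rule has_sum_unique[OF 1])
  then show ?thesis by (simp only: cinner_commute[symmetric])
qed

lemma cadjoint_diag: "cadjoint (diag \<gamma>) = diag (\<lambda>i. cnj (\<gamma> i))"
  unfolding cadjoint_def
proof (rule the_equality)
  fix B assume "\<forall>\<phi> \<psi>. cinner (diag \<gamma> \<phi>) \<psi> = cinner \<phi> (B \<psi>)"
  then show "B = diag (\<lambda>i. cnj (\<gamma> i))"
    by (intro ext cinner_ext) (metis cinner_diag_left)
qed (simp add: cinner_diag_left)

lemma has_sum_adjoint_diag:
  "((\<lambda>i. (complex_of_real ((cmod (\<gamma> i))\<^sup>2) * cinner \<phi> (e i)) *\<^sub>C e i) has_sum
     (cadjoint (diag \<gamma>) \<circ> diag \<gamma>) \<phi>) UNIV"
proof -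
  have "((\<lambda>i. (cnj (\<gamma> i) * cinner (diag \<gamma> \<phi>) (e i)) *\<^sub>C e i) has_sum
      diag (\<lambda>i. cnj (\<gamma> i)) (diag \<gamma> \<phi>)) UNIV"
    by (rule has_sum_diag[where K = K]) (simp add: bounded)
  then show ?thesis
    by (simp add: cadjoint_diag cinner_diag complex_norm_square[unfolded of_real_power] mult_ac)
qed

text \<open>
  The operator \<open>A\<^sup>* A\<close> is diagonal with entries \<open>\<bar>\<gamma> i\<bar>\<^sup>2\<close>. Hence an eigenvector for \<open>\<sigma>\<^sup>2\<close> has vanishing
  coefficients outside the level set \<open>\<bar>\<gamma> i\<bar> = \<sigma>\<close>; since \<open>\<sigma> > 0\<close>, it is recovered from its image and
  has no component orthogonal to the family.
\<close>

lemma eigenspace_adjoint_diag: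
  assumes \<sigma>: "0 < \<sigma>" and fin: "finite {i. cmod (\<gamma> i) = \<sigma>}"
  shows "eigenspace (cadjoint (diag \<gamma>) \<circ> diag \<gamma>) (complex_of_real (\<sigma>\<^sup>2))
    = L2.span (e ` {i. cmod (\<gamma> i) = \<sigma>})" (is "eigenspace ?T ?\<mu> = L2.span (e ` ?I)")
proof
  have lin: "clinear_L2 ?T"
  proof (rule Vector_Spaces.linear_compose[OF linear_diag])
    show "clinear_L2 (cadjoint (diag \<gamma>))"
      unfolding cadjoint_diag by (rule riesz_fischer_family.linear_diag[OF riesz_fischer_family_axioms, where K = K]) (simp add: bounded)
  qed
  interpret T: Vector_Spaces.linear scaleC scaleC ?T by (rule lin)
  show "L2.span (e ` ?I) \<subseteq> eigenspace ?T ?\<mu>"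
  proof (rule L2.span_minimal)
    show "L2.subspace (eigenspace ?T ?\<mu>)"
      by (rule L2.subspaceI)
        (auto simp: eigenspace_def T.add[unfolded comp_def] T.scale[unfolded comp_def] T.zero[unfolded comp_def]
          L2.scale_right_distrib mult.commute)
    have "?T (e j) = ?\<mu> *\<^sub>C e j" if "j \<in> ?I" for j
    proof (rule has_sum_unique[OF has_sum_adjoint_diag])
      have "((\<lambda>i. (complex_of_real ((cmod (\<gamma> i))\<^sup>2) * cinner (e j) (e i)) *\<^sub>C e i) has_sum
          (\<Sum>i\<in>{j}. (complex_of_real ((cmod (\<gamma> i))\<^sup>2) * cinner (e j) (e i)) *\<^sub>C e i)) UNIV"
        by (rule has_sum_finite_support) (auto simp: orthonormal)
      then show "((\<lambda>i. (complex_of_real ((cmod (\<gamma> i))\<^sup>2) * cinner (e j) (e i)) *\<^sub>C e i) has_sum ?\<mu> *\<^sub>C e j) UNIV"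
        using that by (simp add: orthonormal)
    qed
    then show "e ` ?I \<subseteq> eigenspace ?T ?\<mu>" by (auto simp: eigenspace_def)
  qed
  show "eigenspace ?T ?\<mu> \<subseteq> L2.span (e ` ?I)"
  proof
    fix \<phi> assume "\<phi> \<in> eigenspace ?T ?\<mu>"
    then have ev: "?T \<phi> = ?\<mu> *\<^sub>C \<phi>" by (simp add: eigenspace_def)
    have zero: "cinner \<phi> (e j) = 0" if "j \<notin> ?I" for j
    proof -
      have "complex_of_real ((cmod (\<gamma> j))\<^sup>2) * cinner \<phi> (e j) = ?\<mu> * cinner \<phi> (e j)"
        using cinner_has_sum[OF has_sum_adjoint_diag, of \<phi> j] unfolding ev cinner_scaleC_left by (rule sym)
      moreover have "(cmod (\<gamma> j))\<^sup>2 \<noteq> \<sigma>\<^sup>2" using that \<sigma> by (simp add: power2_eq_iff_nonneg)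
      ultimately show ?thesis by (metis mult_right_cancel of_real_eq_iff)
    qed
    let ?g = "\<lambda>i. (complex_of_real ((cmod (\<gamma> i))\<^sup>2) * cinner \<phi> (e i)) *\<^sub>C e i"
    have "(?g has_sum sum ?g ?I) UNIV"
      by (rule has_sum_finite_support) (use fin zero in auto)
    then have eq: "?\<mu> *\<^sub>C \<phi> = sum ?g ?I"
      by (rule has_sum_unique[OF has_sum_adjoint_diag[of \<phi>, unfolded ev]])
    have "\<phi> = inverse ?\<mu> *\<^sub>C (?\<mu> *\<^sub>C \<phi>)" using \<sigma> by simp
    also have "\<dots> \<in> L2.span (e ` ?I)"
      unfolding eq by (intro L2.span_scale L2.span_sum L2.span_base imageI)
    finally show "\<phi> \<in> L2.span (e ` ?I)" .
  qed
qed

end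

lemma inj_e: "inj e"
  by (rule injI) (metis orthonormal of_bool_eq_iff zero_neq_one of_bool_eq(1,2))

lemma dim_span_e:
  assumes "finite I" shows "L2_dim (L2.span (e ` I)) = card I"
proof -
  have inj: "inj_on e I" using inj_e by (rule inj_on_subset) simp
  have "L2.independent (e ` I)"
  proof (rule L2.independent_if_scalars_zero)
    show "finite (e ` I)" using assms by simp
    fix f x assume f: "(\<Sum>x\<in>e ` I. f x *\<^sub>C x) = 0" and "x \<in> e ` I"
    then obtain j where j: "j \<in> I" "x = e j" by auto
    have "(\<Sum>i\<in>I. f (e i) *\<^sub>C e i) = 0" using f inj by (simp add: sum.reindex o_def)
    then have "cinner (\<Sum>i\<in>I. f (e i) *\<^sub>C e i) (e j) = 0"
      using cinner_scaleC_left[of 0 0 "e j"] by simp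
    then show "f x = 0" using j cinner_finite_sum[OF assms, of "\<lambda>i. f (e i)" j] by simp
  qed
  then show ?thesis
    by (simp add: L2.dim_span L2.dim_eq_card_independent card_image inj)
qed

text \<open>
  On the pointwise topology of the coefficient ball the map from coefficients to
  \<open>\<Sum>i. \<gamma> i c i e i\<close> is continuous: it is a uniform limit of finite partial sums, the error being at
  most the largest remaining \<open>\<bar>\<gamma> i\<bar>\<close>. The image of the unit ball under the operator is therefore
  contained in a compact set.
\<close>

lemma compact_diag:
  assumes fin: "\<And>\<epsilon>. 0 < \<epsilon> \<Longrightarrow> finite {i. \<epsilon> \<le> cmod (\<gamma> i)}"
    and bounded: "\<And>i. cmod (\<gamma> i) \<le> K"
  shows "compact_operator (diag \<gamma>)"
proof -
  define T where "T c = (\<Sum>\<^sub>\<infinity>i. (\<gamma> i * c i) *\<^sub>C e i)" for c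
  have sumT: "((\<lambda>i. (\<gamma> i * c i) *\<^sub>C e i) has_sum T c) UNIV" if "c \<in> coeff_ball" for c
    unfolding T_def using that
    by (intro has_sum_infsum summable_weighted[where M = 1 and K = K] bounded) (auto simp: coeff_ball_def)
  have "uniform_limit coeff_ball (\<lambda>F c. \<Sum>i\<in>F. (\<gamma> i * c i) *\<^sub>C e i) T (finite_subsets_at_top UNIV)"
  proof (rule uniform_limitI)
    fix \<epsilon> :: real assume \<epsilon>: "0 < \<epsilon>"
    show "\<forall>\<^sub>F F in finite_subsets_at_top UNIV. \<forall>c\<in>coeff_ball. dist (\<Sum>i\<in>F. (\<gamma> i * c i) *\<^sub>C e i) (T c) < \<epsilon>"
      unfolding eventually_finite_subsets_at_top
    proof (intro exI[of _ "{i. \<epsilon> / 2 \<le> cmod (\<gamma> i)}"] conjI allI impI ballI subset_UNIV)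
      show "finite {i. \<epsilon> / 2 \<le> cmod (\<gamma> i)}" using \<epsilon> by (intro fin) simp
      fix F c assume F: "finite F \<and> {i. \<epsilon> / 2 \<le> cmod (\<gamma> i)} \<subseteq> F \<and> F \<subseteq> UNIV" and c: "c \<in> coeff_ball"
      have "((\<lambda>i. (\<gamma> i * c i) *\<^sub>C e i) has_sum (T c - (\<Sum>i\<in>F. (\<gamma> i * c i) *\<^sub>C e i))) (UNIV - F)"
        by (rule has_sum_Diff[OF sumT[OF c]]) (use F in auto)
      then have "norm (T c - (\<Sum>i\<in>F. (\<gamma> i * c i) *\<^sub>C e i)) \<le> \<epsilon> / 2"
      proof (rule norm_has_sum_le)
        fix G assume G: "finite G" "G \<subseteq> UNIV - F"
        have "(\<Sum>i\<in>G. (cmod (\<gamma> i * c i))\<^sup>2) \<le> (\<Sum>i\<in>G. (\<epsilon> / 2)\<^sup>2 * (cmod (c i))\<^sup>2)"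
        proof (rule sum_mono)
          fix i assume "i \<in> G"
          then have "cmod (\<gamma> i) \<le> \<epsilon> / 2" using G F by force
          then show "(cmod (\<gamma> i * c i))\<^sup>2 \<le> (\<epsilon> / 2)\<^sup>2 * (cmod (c i))\<^sup>2"
            unfolding norm_mult power_mult_distrib by (intro mult_right_mono power_mono) auto
        qed
        also have "\<dots> \<le> (\<epsilon> / 2)\<^sup>2 * 1"
          unfolding sum_distrib_left[symmetric]
          using c G by (intro mult_left_mono) (auto simp: coeff_ball_def)
        finally show "(\<Sum>i\<in>G. (cmod (\<gamma> i * c i))\<^sup>2) \<le> (\<epsilon> / 2)\<^sup>2" by simp
      qed (use \<epsilon> in simp)
      then show "dist (\<Sum>i\<in>F. (\<gamma> i * c i) *\<^sub>C e i) (T c) < \<epsilon>"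
        using \<epsilon> by (simp add: dist_norm norm_minus_commute)
    qed
  qed
  then have "continuous_on coeff_ball T"
  proof (rule uniform_limit_theorem[rotated])
    have "continuous_on coeff_ball (\<lambda>c. (\<gamma> i * c i) *\<^sub>C e i)" for i
      by (intro bounded_linear.continuous_on[OF bounded_linear_scaleC_left] continuous_intros)
        (rule continuous_on_subset[OF continuous_on_product_coordinates], simp)
    then show "\<forall>\<^sub>F F in finite_subsets_at_top UNIV. continuous_on coeff_ball (\<lambda>c. \<Sum>i\<in>F. (\<gamma> i * c i) *\<^sub>C e i)"
      by (intro always_eventually allI continuous_on_sum)
  qed simp
  then have compact: "compact (T ` coeff_ball)"
    using compact_coeff_ball by (rule compact_continuous_image)
  have "diag \<gamma> \<phi> \<in> T ` coeff_ball" if "norm \<phi> \<le> 1" for \<phi>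
  proof (rule image_eqI)
    show "diag \<gamma> \<phi> = T (\<lambda>i. cinner \<phi> (e i))" by (simp add: diag_def T_def)
    have "(norm \<phi>)\<^sup>2 \<le> 1" using that by (simp add: power_le_one)
    then show "(\<lambda>i. cinner \<phi> (e i)) \<in> coeff_ball"
      using bessel order_trans by (fastforce simp: coeff_ball_def)
  qed
  then have "closure (diag \<gamma> ` cball 0 1) \<subseteq> T ` coeff_ball"
    by (intro closure_minimal compact_imp_closed[OF compact]) auto
  then have "compact (closure (diag \<gamma> ` cball 0 1))"
    using compact_Int_closed[OF compact, of "closure (diag \<gamma> ` cball 0 1)"] by (simp add: Int_absorb1)
  then show ?thesis using linear_diag[OF bounded] by (simp add: compact_operator_def)
qed

end

section \<open>Singular values of diagonal operators\<close>

text \<open>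
  The elements of a family tending to zero can be listed in decreasing order: \<open>r i\<close> is the number of
  indices that come before \<open>i\<close>, where larger values come first and ties are broken by an enumeration
  of the index type. Vanishing entries are left out, so that \<open>s\<close> ends in zeros exactly if there are
  finitely many positive entries.
\<close>

lemma decreasing_rearrangement:
  fixes a :: "'i::countable \<Rightarrow> real"
  assumes nonneg: "\<And>i. 0 \<le> a i"
    and fin: "\<And>\<sigma>. 0 < \<sigma> \<Longrightarrow> finite {i. \<sigma> \<le> a i}"
  obtains s :: "nat \<Rightarrow> real" and r :: "'i \<Rightarrow> nat"
  where "decseq s" "\<And>k. 0 \<le> s k" "inj_on r {i. 0 < a i}"
    "\<And>i. 0 < a i \<Longrightarrow> s (r i) = a i" "\<And>k. k \<notin> r ` {i. 0 < a i} \<Longrightarrow> s k = 0"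
proof -
  define before where "before i j \<longleftrightarrow> a j < a i \<or> a i = a j \<and> to_nat i < to_nat j" for i j
  define J where "J = {i. 0 < a i}"
  define r where "r j = card {i. before i j}" for j
  have trans: "before i k" if "before i j" "before j k" for i j k
    using that by (auto simp: before_def)
  have total: "before i j \<or> i = j \<or> before j i" for i j
    by (auto simp: before_def) (metis from_nat_to_nat linorder_cases)
  have irrefl: "\<not> before i i" for i by (auto simp: before_def)
  have finB: "finite {i. before i j}" if "j \<in> J" for j
    by (rule finite_subset[OF _ fin[of "a j"]]) (use that in \<open>auto simp: before_def J_def\<close>)
  have r_less: "r i < r j" if "before i j" "j \<in> J" for i j
    unfolding r_def
    by (rule psubset_card_mono) (use that trans irrefl finB in blast)+
  have B_sub: "i \<in> J" if "before i j" "j \<in> J" for i j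
    using that by (auto simp: before_def J_def)
  have inj: "inj_on r J"
    using r_less total by (metis inj_onI less_irrefl)
  \<comment> \<open>A predecessor set of size \<open>n\<close> is mapped injectively into the numbers below \<open>n\<close>, hence onto them.\<close>
  have initial: "k \<in> r ` J" if "j \<in> J" "k < r j" for j k
  proof -
    have "r ` {i. before i j} = {..<card {i. before i j}}"
    proof (rule card_subset_eq)
      show "r ` {i. before i j} \<subseteq> {..<card {i. before i j}}"
        using r_less[OF _ that(1)] by (auto simp: r_def)
      have "inj_on r {i. before i j}"
        using inj by (rule inj_on_subset) (use B_sub that in blast)
      then show "card (r ` {i. before i j}) = card {..<card {i. before i j}}"
        by (simp add: card_image)
    qed simp
    moreover have "k \<in> {..<card {i. before i j}}" using that by (simp add: r_def)
    ultimately have "k \<in> r ` {i. before i j}" by simp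
    then show ?thesis using B_sub that by blast
  qed
  define s where "s k = (if k \<in> r ` J then a (the_inv_into J r k) else 0)" for k
  have s_r: "s (r i) = a i" if "i \<in> J" for i
    using that inj by (simp add: s_def the_inv_into_f_f)
  have s_0: "s k = 0" if "k \<notin> r ` J" for k using that by (simp add: s_def)
  have s_nonneg: "0 \<le> s k" for k by (simp add: s_def nonneg)
  have "decseq s"
  proof (rule decseq_SucI)
    fix k
    show "s (Suc k) \<le> s k"
    proof (cases "Suc k \<in> r ` J")
      case True
      then obtain j where j: "j \<in> J" "Suc k = r j" by auto
      then obtain i where i: "i \<in> J" "k = r i" using initial[of j k] by auto
      have "\<not> before j i" using r_less[of j i] i j by auto
      then show ?thesis using j i by (simp add: s_r) (auto simp: before_def)
    qed (simp add: s_0 s_nonneg)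
  qed
  then show ?thesis
    using that[of s r] s_nonneg inj s_r s_0 by (auto simp: J_def)
qed

lemma finite_superlevel_powr:
  fixes a :: "'i \<Rightarrow> real"
  assumes "(\<lambda>i. a i powr p) summable_on UNIV" and "\<And>i. 0 \<le> a i" and "0 < p" and "0 < \<sigma>"
  shows "finite {i. \<sigma> \<le> a i}"
proof (rule ccontr)
  assume inf: "infinite {i. \<sigma> \<le> a i}"
  have "(\<lambda>i. \<sigma> powr p) summable_on {i. \<sigma> \<le> a i}"
  proof (rule abs_summable_summable, rule Infinite_Sum.abs_summable_on_comparison_test)
    have "(\<lambda>i. a i powr p) summable_on {i. \<sigma> \<le> a i}"
      using assms(1) by (rule summable_on_subset_banach) simp
    then show "(\<lambda>i. norm (a i powr p)) summable_on {i. \<sigma> \<le> a i}" by simp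
    show "norm (\<sigma> powr p) \<le> norm (a i powr p)" if "i \<in> {i. \<sigma> \<le> a i}" for i
      using that assms by (auto intro!: powr_mono2)
  qed
  then show False
    using inf assms(4) infsum_diverge_constant[of "{i. \<sigma> \<le> a i}" "\<sigma> powr p"] by simp
qed

context riesz_fischer_family
begin

lemma diag_in_schatten_class:
  assumes p: "0 < p" and summable: "(\<lambda>i. cmod (\<gamma> i) powr p) summable_on UNIV"
  shows "diag \<gamma> \<in> schatten_class p"
proof -
  have fin: "finite {i. \<sigma> \<le> cmod (\<gamma> i)}" if "0 < \<sigma>" for \<sigma>
    using summable norm_ge_zero p that by (rule finite_superlevel_powr)
  define K where "K = 1 + (\<Sum>i | 1 \<le> cmod (\<gamma> i). cmod (\<gamma> i))"
  have bounded: "cmod (\<gamma> i) \<le> K" for i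
  proof (cases "1 \<le> cmod (\<gamma> i)")
    case True
    then have "cmod (\<gamma> i) \<le> (\<Sum>i | 1 \<le> cmod (\<gamma> i). cmod (\<gamma> i))"
      by (intro member_le_sum fin) auto
    then show ?thesis by (simp add: K_def)
  next
    case False
    moreover have "0 \<le> (\<Sum>i | 1 \<le> cmod (\<gamma> i). cmod (\<gamma> i))" by (rule sum_nonneg) simp
    ultimately show ?thesis by (simp add: K_def)
  qed
  obtain s r where s: "decseq s" "\<And>k. 0 \<le> s k"
    and r: "inj_on r {i. 0 < cmod (\<gamma> i)}" "\<And>i. 0 < cmod (\<gamma> i) \<Longrightarrow> s (r i) = cmod (\<gamma> i)"
    and s0: "\<And>k. k \<notin> r ` {i. 0 < cmod (\<gamma> i)} \<Longrightarrow> s k = 0"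
    using decreasing_rearrangement[of "\<lambda>i. cmod (\<gamma> i)"] fin by auto
  have "singular_values (diag \<gamma>) s"
    unfolding singular_values_def
  proof (intro conjI allI impI s)
    fix \<sigma> :: real assume \<sigma>: "0 < \<sigma>"
    have level: "{k. s k = \<sigma>} = r ` {i. cmod (\<gamma> i) = \<sigma>}"
    proof (intro equalityI subsetI)
      fix k assume "k \<in> {k. s k = \<sigma>}"
      then have k: "s k = \<sigma>" by simp
      then have "k \<in> r ` {i. 0 < cmod (\<gamma> i)}" using s0 \<sigma> by fastforce
      then show "k \<in> r ` {i. cmod (\<gamma> i) = \<sigma>}" using r(2) k by auto
    qed (use \<sigma> r(2) in auto)
    have fin\<sigma>: "finite {i. cmod (\<gamma> i) = \<sigma>}"
      by (rule finite_subset[OF _ fin[OF \<sigma>]]) auto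
    show "finite {k. s k = \<sigma>}" unfolding level using fin\<sigma> by (rule finite_imageI)
    have "card {k. s k = \<sigma>} = card {i. cmod (\<gamma> i) = \<sigma>}"
      unfolding level by (rule card_image, rule inj_on_subset[OF r(1)]) (use \<sigma> in auto)
    then show "card {k. s k = \<sigma>} = L2_dim (eigenspace (cadjoint (diag \<gamma>) \<circ> diag \<gamma>) (complex_of_real (\<sigma>\<^sup>2)))"
      by (simp only: eigenspace_adjoint_diag[OF bounded \<sigma> fin\<sigma>] dim_span_e[OF fin\<sigma>])
  qed
  moreover have "summable (\<lambda>k. s k powr p)"
  proof (rule summable_on_imp_summable)
    have "(\<lambda>i. cmod (\<gamma> i) powr p) summable_on {i. 0 < cmod (\<gamma> i)}"
      using summable by (rule summable_on_subset_banach) simp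
    then have "((\<lambda>k. s k powr p) \<circ> r) summable_on {i. 0 < cmod (\<gamma> i)}"
      by (rule summable_on_cong[THEN iffD1, rotated]) (simp add: r(2))
    then have "(\<lambda>k. s k powr p) summable_on r ` {i. 0 < cmod (\<gamma> i)}"
      by (rule summable_on_reindex[OF r(1), THEN iffD2])
    then show "(\<lambda>k. s k powr p) summable_on UNIV"
      by (rule summable_on_cong_neutral[THEN iffD1, rotated -1]) (auto simp: s0)
  qed
  ultimately show ?thesis
    using compact_diag[OF fin bounded] by (auto simp: schatten_class_def)
qed

end

section \<open>Functions with disjoint supports\<close>

lemma norm_abs_L2:
  assumes "square_integrable f"
  shows "(norm (abs_L2 f))\<^sup>2 = (LINT t|lborel. (cmod (f t))\<^sup>2)"
proof -
  have "L2_rel f f" using assms by (simp add: L2_rel_def)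
  then have "complex_of_real ((norm (abs_L2 f))\<^sup>2) = (LINT t|lborel. f t * cnj (f t))"
    unfolding cinner_self[symmetric] by (simp only: cinner.abs_eq)
  also have "\<dots> = complex_of_real (LINT t|lborel. (cmod (f t))\<^sup>2)"
    unfolding complex_norm_square[symmetric] by (rule integral_complex_of_real)
  finally show ?thesis by (simp only: of_real_eq_iff)
qed

text \<open>
  The function \<open>idx\<close> names the only member of the family that may be non-zero at a given point. With it,
  an infinite linear combination is a single term at every point, and no pointwise convergence has to
  be considered.
\<close>

locale disjoint_functions =
  fixes g :: "'i::countable \<Rightarrow> 'a::euclidean_space \<Rightarrow> complex" and idx :: "'a \<Rightarrow> 'i"
  assumes square_integrable_g: "square_integrable (g i)"
    and norm_g: "(LINT t|lborel. (cmod (g i t))\<^sup>2) = 1"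
    and measurable_idx: "idx \<in> borel \<rightarrow>\<^sub>M count_space UNIV"
    and support: "g i t \<noteq> 0 \<Longrightarrow> idx t = i"
begin

definition combine :: "('i \<Rightarrow> complex) \<Rightarrow> 'a \<Rightarrow> complex" where
  "combine c t = c (idx t) * g (idx t) t"

lemma measurable_combine: "combine c \<in> borel_measurable borel"
  unfolding combine_def[abs_def]
proof (rule measurable_compose_countable[OF _ measurable_idx])
  have [measurable]: "g i \<in> borel_measurable borel" for i
    using square_integrable_g[of i] by (simp add: square_integrable_def)
  show "(\<lambda>t. c i * g i t) \<in> borel_measurable borel" for i
    by measurable
qed

lemma combine_square:
  assumes c: "(\<lambda>i. (cmod (c i))\<^sup>2) summable_on UNIV"
  shows "square_integrable (combine c)" "(LINT t|lborel. (cmod (combine c t))\<^sup>2) = (\<Sum>\<^sub>\<infinity>i. (cmod (c i))\<^sup>2)"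
proof -
  have [measurable]: "g i \<in> borel_measurable borel" for i
    using square_integrable_g[of i] by (simp add: square_integrable_def)
  have norm1: "(\<integral>\<^sup>+t. ennreal ((cmod (g i t))\<^sup>2) \<partial>lborel) = 1" for i
    using square_integrable_g[of i] norm_g[of i] unfolding square_integrable_def
    by (subst nn_integral_eq_integral) auto
  have pointwise: "ennreal ((cmod (combine c t))\<^sup>2)
      = (\<integral>\<^sup>+i. ennreal ((cmod (c i))\<^sup>2) * ennreal ((cmod (g i t))\<^sup>2) \<partial>count_space UNIV)" for t
  proof -
    have "(\<integral>\<^sup>+i. ennreal ((cmod (c i))\<^sup>2) * ennreal ((cmod (g i t))\<^sup>2) \<partial>count_space UNIV)
        = (\<Sum>i\<in>{idx t}. ennreal ((cmod (c i))\<^sup>2) * ennreal ((cmod (g i t))\<^sup>2))"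
      using support[of _ t] by (intro nn_integral_count_space') force+
    then show ?thesis
      by (simp add: combine_def norm_mult power_mult_distrib ennreal_mult)
  qed
  have "Infinite_Set_Sum.abs_summable_on (\<lambda>i. (cmod (c i))\<^sup>2) UNIV"
    unfolding abs_summable_equivalent[symmetric] using c by simp
  then have "(\<integral>\<^sup>+i. ennreal ((cmod (c i))\<^sup>2) \<partial>count_space UNIV) = ennreal (\<Sum>\<^sub>\<infinity>i. (cmod (c i))\<^sup>2)"
    by (subst nn_integral_conv_infsetsum) (simp_all add: infsetsum_infsum)
  moreover have "(\<integral>\<^sup>+t. ennreal ((cmod (combine c t))\<^sup>2) \<partial>lborel) = (\<integral>\<^sup>+i. ennreal ((cmod (c i))\<^sup>2) \<partial>count_space UNIV)"
    unfolding pointwise by (subst nn_integral_count_space_nn_integral) (simp_all add: nn_integral_cmult norm1)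
  ultimately have nn: "(\<integral>\<^sup>+t. ennreal ((cmod (combine c t))\<^sup>2) \<partial>lborel) = ennreal (\<Sum>\<^sub>\<infinity>i. (cmod (c i))\<^sup>2)"
    by simp
  have [measurable]: "combine c \<in> borel_measurable borel" by (rule measurable_combine)
  have int: "integrable lborel (\<lambda>t. (cmod (combine c t))\<^sup>2)"
    by (rule integrableI_bounded) (simp_all add: nn)
  then show "square_integrable (combine c)"
    by (simp add: square_integrable_def measurable_combine)
  show "(LINT t|lborel. (cmod (combine c t))\<^sup>2) = (\<Sum>\<^sub>\<infinity>i. (cmod (c i))\<^sup>2)"
    by (subst integral_eq_nn_integral) (simp_all add: nn infsum_nonneg)
qed

lemma finite_combination:
  assumes "finite F"
  shows "(\<Sum>i\<in>F. c i *\<^sub>C abs_L2 (g i)) = abs_L2 (combine (\<lambda>i. if i \<in> F then c i else 0))"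
  using assms
proof induction
  case empty
  then show ?case by (simp add: combine_def[abs_def] zero_L2.abs_eq)
next
  case (insert j F)
  have sq: "square_integrable (combine (\<lambda>i. if i \<in> F then c i else 0))"
    by (rule combine_square, rule summable_on_cong_neutral[THEN iffD1, OF _ _ _ summable_on_finite[OF insert(1)]]) auto
  have "combine (\<lambda>i. if i \<in> insert j F then c i else 0) = (\<lambda>t. c j * g j t + combine (\<lambda>i. if i \<in> F then c i else 0) t)"
    using insert(2) support by (fastforce simp: combine_def fun_eq_iff)
  then show ?case
    using insert sq square_integrable_g[of j] square_integrable_scale[OF square_integrable_g[of j], of "c j"]
    by (simp add: scaleC.abs_eq plus_L2.abs_eq L2_rel_def)
qed

text \<open>
  The pointwise combination is the limit of the partial sums, since the square of its distance from
  a partial sum is the corresponding tail of the coefficient series.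
\<close>

sublocale riesz_fischer_family "\<lambda>i. abs_L2 (g i)"
proof
  fix i j
  have rel: "L2_rel (g i) (g i)" for i using square_integrable_g by (simp add: L2_rel_def)
  show "cinner (abs_L2 (g i)) (abs_L2 (g j)) = of_bool (i = j)"
  proof (cases "i = j")
    case True
    have "(norm (abs_L2 (g j)))\<^sup>2 = 1" using norm_abs_L2[OF square_integrable_g] norm_g by simp
    then show ?thesis unfolding True cinner_self by simp
  next
    case False
    then have "g i t = 0 \<or> g j t = 0" for t using support[of i t] support[of j t] by auto
    then have "g i t * cnj (g j t) = 0" for t by simp
    then have "(LINT t|lborel. g i t * cnj (g j t)) = 0"
      by (simp only: Bochner_Integration.integral_zero)
    then show ?thesis using False by (simp add: cinner.abs_eq rel)
  qed
next
  fix c :: "'i \<Rightarrow> complex"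
  assume c: "(\<lambda>i. (cmod (c i))\<^sup>2) summable_on UNIV"
  let ?e = "\<lambda>i. c i *\<^sub>C abs_L2 (g i)"
  have dist: "dist (sum ?e F) (abs_L2 (combine c)) = sqrt ((\<Sum>\<^sub>\<infinity>i. (cmod (c i))\<^sup>2) - (\<Sum>i\<in>F. (cmod (c i))\<^sup>2))"
    if F: "finite F" for F
  proof -
    define d where "d i = (if i \<in> F then 0 else c i)" for i
    have d: "((\<lambda>i. (cmod (d i))\<^sup>2) has_sum ((\<Sum>\<^sub>\<infinity>i. (cmod (c i))\<^sup>2) - (\<Sum>i\<in>F. (cmod (c i))\<^sup>2))) UNIV"
      by (rule has_sum_cong_neutral[THEN iffD1, OF _ _ _ has_sum_Diff[OF has_sum_infsum[OF c] has_sum_finite[OF F]]])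
        (auto simp: d_def)
    have sF: "square_integrable (combine (\<lambda>i. if i \<in> F then c i else 0))"
      by (rule combine_square, rule summable_on_cong_neutral[THEN iffD1, OF _ _ _ summable_on_finite[OF F]]) auto
    have sd: "square_integrable (combine d)"
      by (rule combine_square) (use d in \<open>auto simp: summable_on_def\<close>)
    have "combine c = (\<lambda>t. combine d t + combine (\<lambda>i. if i \<in> F then c i else 0) t)"
      by (auto simp: combine_def d_def fun_eq_iff)
    then have "abs_L2 (combine c) = abs_L2 (combine d) + sum ?e F"
      using sF sd by (simp add: finite_combination[OF F] plus_L2.abs_eq L2_rel_def)
    then have "dist (sum ?e F) (abs_L2 (combine c)) = norm (abs_L2 (combine d))"
      by (simp add: dist_norm norm_minus_commute)
    also have "\<dots> = sqrt (\<Sum>\<^sub>\<infinity>i. (cmod (d i))\<^sup>2)"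
      using norm_abs_L2[OF sd] combine_square(2)[of d] d by (intro real_sqrt_unique[symmetric]) (auto simp: summable_on_def)
    also have "(\<Sum>\<^sub>\<infinity>i. (cmod (d i))\<^sup>2) = (\<Sum>\<^sub>\<infinity>i. (cmod (c i))\<^sup>2) - (\<Sum>i\<in>F. (cmod (c i))\<^sup>2)"
      using d by (rule infsumI)
    finally show ?thesis .
  qed
  have "((\<lambda>F. sqrt ((\<Sum>\<^sub>\<infinity>i. (cmod (c i))\<^sup>2) - (\<Sum>i\<in>F. (cmod (c i))\<^sup>2))) \<longlongrightarrow> sqrt ((\<Sum>\<^sub>\<infinity>i. (cmod (c i))\<^sup>2) - (\<Sum>\<^sub>\<infinity>i. (cmod (c i))\<^sup>2))) (finite_subsets_at_top UNIV)"
    by (intro tendsto_intros infsum_tendsto c)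
  then have "((\<lambda>F. sqrt ((\<Sum>\<^sub>\<infinity>i. (cmod (c i))\<^sup>2) - (\<Sum>i\<in>F. (cmod (c i))\<^sup>2))) \<longlongrightarrow> 0) (finite_subsets_at_top UNIV)"
    by (simp only: diff_self real_sqrt_zero)
  moreover have "\<forall>\<^sub>F F in finite_subsets_at_top UNIV.
      sqrt ((\<Sum>\<^sub>\<infinity>i. (cmod (c i))\<^sup>2) - (\<Sum>i\<in>F. (cmod (c i))\<^sup>2)) = dist (sum ?e F) (abs_L2 (combine c))"
    by (rule eventually_finite_subsets_at_top_weakI) (simp only: dist)
  ultimately have "((\<lambda>F. dist (sum ?e F) (abs_L2 (combine c))) \<longlongrightarrow> 0) (finite_subsets_at_top UNIV)"
    by (rule Lim_transform_eventually)
  then have "(?e has_sum abs_L2 (combine c)) UNIV"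
    unfolding has_sum_def by (subst tendsto_dist_iff)
  then show "?e summable_on UNIV" by (auto simp: summable_on_def)
qed

end

section \<open>Oscillatory integrals\<close>

text \<open>
  A form of van der Corput's lemma without case distinction. Integrating
  \<open>e\<^bsup>i\<phi>\<^esup>\<close> by parts through \<open>e\<^bsup>i\<phi>\<^esup> / (i\<phi>')\<close> fails near the zeros of \<open>\<phi>'\<close>. Replacing
  \<open>1 / \<phi>'\<close> by \<open>\<phi>' / (\<phi>'\<^sup>2 + N)\<close> removes the singularity; this function is at most \<open>1 / (2\<surd>N)\<close>,
  and the error terms are controlled by the integral on the right-hand side.
\<close>

lemma oscillatory_integral_bound:
  fixes \<phi> \<phi>' \<phi>'' :: "real \<Rightarrow> real"
  assumes ab: "a \<le> b" and N: "0 < N"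
    and d1: "\<And>u. u \<in> {a..b} \<Longrightarrow> (\<phi> has_real_derivative \<phi>' u) (at u)"
    and d2: "\<And>u. u \<in> {a..b} \<Longrightarrow> (\<phi>' has_real_derivative \<phi>'' u) (at u)"
    and cont: "continuous_on {a..b} \<phi>''"
  shows "cmod (integral {a..b} (\<lambda>u. cis (\<phi> u)))
    \<le> 1 / sqrt N + integral {a..b} (\<lambda>u. (N + \<bar>\<phi>'' u\<bar>) / ((\<phi>' u)\<^sup>2 + N))"
proof -
  define F where "F u = cis (\<phi> u) * (- \<i> * complex_of_real (\<phi>' u / ((\<phi>' u)\<^sup>2 + N)))" for u
  define E where "E u = complex_of_real (N / ((\<phi>' u)\<^sup>2 + N)) + \<i> * complex_of_real (\<phi>'' u * (N - (\<phi>' u)\<^sup>2) / ((\<phi>' u)\<^sup>2 + N)\<^sup>2)" for u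
  have pos: "(\<phi>' u)\<^sup>2 + N > 0" for u using N by (simp add: add_nonneg_pos)
  have nz: "(\<phi>' u)\<^sup>2 + N \<noteq> 0" for u using pos[of u] by simp
  have contd: "continuous_on {a..b} \<phi>" "continuous_on {a..b} \<phi>'"
    using d1 d2 by (auto intro!: DERIV_atLeastAtMost_imp_continuous_on)
  have der: "(F has_vector_derivative (cis (\<phi> u) - cis (\<phi> u) * E u)) (at u within {a..b})" if u: "u \<in> {a..b}" for u
  proof -
    have c: "((\<lambda>u. cis (\<phi> u)) has_vector_derivative (\<phi>' u *\<^sub>R (\<i> * cis (\<phi> u)))) (at u within {a..b})"
      unfolding has_vector_derivative_def
      by (rule has_derivative_eq_rhs[OF has_derivative_cis])
        (use d1[OF u] in \<open>auto simp: has_real_derivative_iff_has_vector_derivative has_vector_derivative_def intro: has_derivative_at_withinI\<close>)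
    have q: "((\<lambda>u. \<phi>' u / ((\<phi>' u)\<^sup>2 + N)) has_real_derivative (\<phi>'' u * (N - (\<phi>' u)\<^sup>2) / ((\<phi>' u)\<^sup>2 + N)\<^sup>2)) (at u within {a..b})"
      by (rule DERIV_subset[of _ _ _ UNIV])
        (use nz[of u] in \<open>auto intro!: derivative_eq_intros d2[OF u] simp: field_simps power2_eq_square\<close>)
    have q': "((\<lambda>u. - \<i> * complex_of_real (\<phi>' u / ((\<phi>' u)\<^sup>2 + N))) has_vector_derivative (- \<i> * complex_of_real (\<phi>'' u * (N - (\<phi>' u)\<^sup>2) / ((\<phi>' u)\<^sup>2 + N)\<^sup>2))) (at u within {a..b})"
      by (intro has_vector_derivative_mult_right has_vector_derivative_of_real) (use q in \<open>simp add: has_real_derivative_iff_has_vector_derivative\<close>)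
    have eq: "\<phi>' u * (\<phi>' u / ((\<phi>' u)\<^sup>2 + N)) = 1 - N / ((\<phi>' u)\<^sup>2 + N)"
      using nz[of u] by (simp add: field_simps power2_eq_square)
    have alg: "c * (- \<i> * complex_of_real d) + (x *\<^sub>R (\<i> * c)) * (- \<i> * complex_of_real q)
        = c - c * (complex_of_real n + \<i> * complex_of_real d)" if "x * q = 1 - n" for c x d q n
    proof -
      have "(x *\<^sub>R (\<i> * c)) * (- \<i> * complex_of_real q) = c * complex_of_real (x * q)"
        by (simp add: scaleR_conv_of_real mult_ac)
      then show ?thesis unfolding that by (simp add: algebra_simps)
    qed
    show ?thesis
      unfolding F_def E_def
      by (rule has_vector_derivative_eq_rhs[OF has_vector_derivative_mult[OF c q'] alg[OF eq]])
  qed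
  have ftc: "((\<lambda>u. cis (\<phi> u) - cis (\<phi> u) * E u) has_integral (F b - F a)) {a..b}"
    by (rule fundamental_theorem_of_calculus[OF ab der])
  have contE: "continuous_on {a..b} E"
    unfolding E_def using nz by (intro continuous_intros cont contd) auto
  have contc: "continuous_on {a..b} (\<lambda>u. cis (\<phi> u))"
    unfolding cis_conv_exp by (intro continuous_intros contd)
  have eq: "integral {a..b} (\<lambda>u. cis (\<phi> u)) = F b - F a + integral {a..b} (\<lambda>u. cis (\<phi> u) * E u)"
  proof -
    have "((\<lambda>u. cis (\<phi> u) * E u) has_integral integral {a..b} (\<lambda>u. cis (\<phi> u) * E u)) {a..b}"
      by (intro integrable_integral integrable_continuous_interval continuous_intros contc contE)
    from has_integral_add[OF ftc this] show ?thesis by (simp add: integral_unique)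
  qed
  have normF: "cmod (F u) \<le> 1 / (2 * sqrt N)" for u
  proof -
    have "0 \<le> (\<bar>\<phi>' u\<bar> - sqrt N)\<^sup>2" by simp
    then have "2 * sqrt N * \<bar>\<phi>' u\<bar> \<le> (\<phi>' u)\<^sup>2 + N"
      using N by (simp add: power2_diff algebra_simps)
    then have "\<bar>\<phi>' u\<bar> / ((\<phi>' u)\<^sup>2 + N) \<le> 1 / (2 * sqrt N)"
      using pos[of u] N by (simp add: field_simps)
    then show ?thesis using pos[of u] by (simp add: F_def norm_mult norm_divide del: of_real_divide of_real_add of_real_power)
  qed
  have normE: "cmod (E u) \<le> (N + \<bar>\<phi>'' u\<bar>) / ((\<phi>' u)\<^sup>2 + N)" for u
  proof -
    have "cmod (E u) \<le> \<bar>N / ((\<phi>' u)\<^sup>2 + N)\<bar> + \<bar>\<phi>'' u * (N - (\<phi>' u)\<^sup>2) / ((\<phi>' u)\<^sup>2 + N)\<^sup>2\<bar>"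
      unfolding E_def by (rule order_trans[OF norm_triangle_ineq]) (simp only: norm_mult norm_of_real norm_ii mult_1)
    also have "\<bar>N / ((\<phi>' u)\<^sup>2 + N)\<bar> = N / ((\<phi>' u)\<^sup>2 + N)" using pos[of u] N by simp
    also have "\<bar>\<phi>'' u * (N - (\<phi>' u)\<^sup>2) / ((\<phi>' u)\<^sup>2 + N)\<^sup>2\<bar> \<le> \<bar>\<phi>'' u\<bar> / ((\<phi>' u)\<^sup>2 + N)"
    proof -
      have "\<bar>N - (\<phi>' u)\<^sup>2\<bar> \<le> (\<phi>' u)\<^sup>2 + N" using N by (auto simp: abs_le_iff)
      then have "\<bar>\<phi>'' u\<bar> * \<bar>N - (\<phi>' u)\<^sup>2\<bar> / ((\<phi>' u)\<^sup>2 + N)\<^sup>2 \<le> \<bar>\<phi>'' u\<bar> * ((\<phi>' u)\<^sup>2 + N) / ((\<phi>' u)\<^sup>2 + N)\<^sup>2"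
        by (intro divide_right_mono mult_left_mono) auto
      then show ?thesis using nz[of u] by (simp add: abs_mult power2_eq_square)
    qed
    finally show ?thesis by (simp add: add_divide_distrib)
  qed
  have "cmod (integral {a..b} (\<lambda>u. cis (\<phi> u) * E u)) \<le> integral {a..b} (\<lambda>u. (N + \<bar>\<phi>'' u\<bar>) / ((\<phi>' u)\<^sup>2 + N))"
  proof (rule integral_norm_bound_integral)
    show "(\<lambda>u. cis (\<phi> u) * E u) integrable_on {a..b}"
      by (intro integrable_continuous_interval continuous_intros contc contE)
    show "(\<lambda>u. (N + \<bar>\<phi>'' u\<bar>) / ((\<phi>' u)\<^sup>2 + N)) integrable_on {a..b}"
      using nz by (intro integrable_continuous_interval continuous_intros contd cont) auto
    show "cmod (cis (\<phi> u) * E u) \<le> (N + \<bar>\<phi>'' u\<bar>) / ((\<phi>' u)\<^sup>2 + N)" for u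
      using normE[of u] by (simp add: norm_mult)
  qed
  moreover have "cmod (F b - F a) \<le> 1 / sqrt N"
    using norm_triangle_ineq4[of "F b" "F a"] normF[of a] normF[of b] by (simp add: field_simps)
  ultimately show ?thesis
    unfolding eq by (intro order_trans[OF norm_triangle_ineq] add_mono) auto
qed

text \<open>
  If \<open>\<phi>''\<close> has constant sign and is bounded below, the error integrand of the previous bound is at most
  three times the derivative of \<open>\<plusminus> arctan (\<phi>' / \<surd>N) / \<surd>N\<close>, so that no upper bound for
  \<open>\<phi>''\<close> is required.
\<close>

lemma van_der_corput_curvature:
  fixes \<phi> \<phi>' \<phi>'' :: "real \<Rightarrow> real"
  assumes ab: "a \<le> b" and N: "0 < N"
    and d1: "\<And>u. u \<in> {a..b} \<Longrightarrow> (\<phi> has_real_derivative \<phi>' u) (at u)"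
    and d2: "\<And>u. u \<in> {a..b} \<Longrightarrow> (\<phi>' has_real_derivative \<phi>'' u) (at u)"
    and cont: "continuous_on {a..b} \<phi>''"
    and \<epsilon>: "\<bar>\<epsilon>\<bar> = 1" and lower: "\<And>u. u \<in> {a..b} \<Longrightarrow> N / 2 \<le> \<epsilon> * \<phi>'' u"
  shows "cmod (integral {a..b} (\<lambda>u. cis (\<phi> u))) \<le> (1 + 3 * pi) / sqrt N"
proof -
  have pos: "(\<phi>' u)\<^sup>2 + N > 0" for u using N by (simp add: add_nonneg_pos)
  have nz: "(\<phi>' u)\<^sup>2 + N \<noteq> 0" for u using pos[of u] by simp
  have contd: "continuous_on {a..b} \<phi>'"
    using d2 by (auto intro!: DERIV_atLeastAtMost_imp_continuous_on)
  define H where "H u = arctan (\<phi>' u / sqrt N)" for u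
  have H: "((\<lambda>u. 3 * \<epsilon> / sqrt N * H u) has_real_derivative 3 * (\<epsilon> * \<phi>'' u) / ((\<phi>' u)\<^sup>2 + N)) (at u within {a..b})"
    if u: "u \<in> {a..b}" for u
  proof -
    have "(H has_real_derivative inverse (1 + (\<phi>' u / sqrt N)\<^sup>2) * (\<phi>'' u / sqrt N)) (at u)"
      unfolding H_def by (rule DERIV_chain2[OF DERIV_arctan DERIV_cdivide[OF d2[OF u]]])
    from DERIV_cmult[OF this, of "3 * \<epsilon> / sqrt N"]
    have "((\<lambda>u. 3 * \<epsilon> / sqrt N * H u) has_real_derivative 3 * \<epsilon> / sqrt N * (inverse (1 + (\<phi>' u / sqrt N)\<^sup>2) * (\<phi>'' u / sqrt N))) (at u)" .
    moreover have "3 * \<epsilon> / sqrt N * (inverse (1 + (\<phi>' u / sqrt N)\<^sup>2) * (\<phi>'' u / sqrt N)) = 3 * (\<epsilon> * \<phi>'' u) / ((\<phi>' u)\<^sup>2 + N)"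
    proof -
      have "3 * \<epsilon> / sqrt N * (inverse (1 + (\<phi>' u / sqrt N)\<^sup>2) * (\<phi>'' u / sqrt N))
          = 3 * (\<epsilon> * \<phi>'' u) * (inverse ((sqrt N)\<^sup>2) * inverse (1 + (\<phi>' u)\<^sup>2 / (sqrt N)\<^sup>2))"
        unfolding power_divide by (simp only: divide_inverse power2_eq_square inverse_mult_distrib mult_ac)
      also have "inverse ((sqrt N)\<^sup>2) * inverse (1 + (\<phi>' u)\<^sup>2 / (sqrt N)\<^sup>2) = inverse ((\<phi>' u)\<^sup>2 + N)"
        using N by (simp add: inverse_mult_distrib[symmetric] distrib_left add.commute del: inverse_mult_distrib)
      finally show ?thesis by (simp add: divide_inverse)
    qed
    ultimately show ?thesis by (simp add: has_field_derivative_at_within)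
  qed
  have "((\<lambda>u. 3 * (\<epsilon> * \<phi>'' u) / ((\<phi>' u)\<^sup>2 + N)) has_integral (3 * \<epsilon> / sqrt N * H b - 3 * \<epsilon> / sqrt N * H a)) {a..b}"
    by (rule fundamental_theorem_of_calculus[OF ab])
      (use H in \<open>simp add: has_real_derivative_iff_has_vector_derivative\<close>)
  then have I: "integral {a..b} (\<lambda>u. 3 * (\<epsilon> * \<phi>'' u) / ((\<phi>' u)\<^sup>2 + N)) = 3 / sqrt N * (\<epsilon> * (H b - H a))"
    by (simp add: integral_unique algebra_simps)
  have "\<bar>\<epsilon> * (H b - H a)\<bar> \<le> pi"
    unfolding abs_mult \<epsilon> H_def using arctan_bounded[of "\<phi>' a / sqrt N"] arctan_bounded[of "\<phi>' b / sqrt N"]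
    by (simp add: abs_le_iff)
  then have "3 / sqrt N * (\<epsilon> * (H b - H a)) \<le> 3 / sqrt N * pi"
    using N by (intro mult_left_mono) (auto simp: abs_le_iff)
  moreover have "integral {a..b} (\<lambda>u. (N + \<bar>\<phi>'' u\<bar>) / ((\<phi>' u)\<^sup>2 + N)) \<le> integral {a..b} (\<lambda>u. 3 * (\<epsilon> * \<phi>'' u) / ((\<phi>' u)\<^sup>2 + N))"
  proof (rule integral_le)
    show "(\<lambda>u. (N + \<bar>\<phi>'' u\<bar>) / ((\<phi>' u)\<^sup>2 + N)) integrable_on {a..b}"
      "(\<lambda>u. 3 * (\<epsilon> * \<phi>'' u) / ((\<phi>' u)\<^sup>2 + N)) integrable_on {a..b}"
      using nz by (auto intro!: integrable_continuous_interval continuous_intros contd cont)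
    fix u assume u: "u \<in> {a..b}"
    have "\<bar>\<phi>'' u\<bar> = \<bar>\<epsilon> * \<phi>'' u\<bar>" by (simp add: abs_mult \<epsilon>)
    also have "\<dots> = \<epsilon> * \<phi>'' u" using lower[OF u] N by linarith
    finally show "(N + \<bar>\<phi>'' u\<bar>) / ((\<phi>' u)\<^sup>2 + N) \<le> 3 * (\<epsilon> * \<phi>'' u) / ((\<phi>' u)\<^sup>2 + N)"
      using lower[OF u] pos[of u] by (intro divide_right_mono) auto
  qed
  ultimately show ?thesis
    using oscillatory_integral_bound[OF ab N d1 d2 cont] I by (simp add: add_divide_distrib)
qed

lemma van_der_corput_slope:
  fixes \<phi> \<phi>' \<phi>'' :: "real \<Rightarrow> real"
  assumes ab: "a \<le> b" and N: "1 \<le> N"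
    and d1: "\<And>u. u \<in> {a..b} \<Longrightarrow> (\<phi> has_real_derivative \<phi>' u) (at u)"
    and d2: "\<And>u. u \<in> {a..b} \<Longrightarrow> (\<phi>' has_real_derivative \<phi>'' u) (at u)"
    and cont: "continuous_on {a..b} \<phi>''"
    and lower: "\<And>u. u \<in> {a..b} \<Longrightarrow> N / 2 \<le> \<bar>\<phi>' u\<bar>"
    and upper: "\<And>u. u \<in> {a..b} \<Longrightarrow> \<bar>\<phi>'' u\<bar> \<le> 4 * N"
  shows "cmod (integral {a..b} (\<lambda>u. cis (\<phi> u))) \<le> (1 + 20 * (b - a)) / sqrt N"
proof -
  have N0: "0 < N" using N by simp
  have pos: "(\<phi>' u)\<^sup>2 + N > 0" for u using N by (simp add: add_nonneg_pos)
  have nz: "(\<phi>' u)\<^sup>2 + N \<noteq> 0" for u using pos[of u] by simp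
  have contd: "continuous_on {a..b} \<phi>'"
    using d2 by (auto intro!: DERIV_atLeastAtMost_imp_continuous_on)
  have "integral {a..b} (\<lambda>u. (N + \<bar>\<phi>'' u\<bar>) / ((\<phi>' u)\<^sup>2 + N)) \<le> integral {a..b} (\<lambda>u. 20 / sqrt N)"
  proof (rule integral_le)
    show "(\<lambda>u. (N + \<bar>\<phi>'' u\<bar>) / ((\<phi>' u)\<^sup>2 + N)) integrable_on {a..b}"
      using nz by (auto intro!: integrable_continuous_interval continuous_intros contd cont)
    fix u assume u: "u \<in> {a..b}"
    have "(N / 2)\<^sup>2 \<le> \<bar>\<phi>' u\<bar>\<^sup>2" using lower[OF u] N by (intro power_mono) auto
    then have "(N + \<bar>\<phi>'' u\<bar>) / ((\<phi>' u)\<^sup>2 + N) \<le> (5 * N) / ((N / 2)\<^sup>2)"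
      using upper[OF u] N by (intro frac_le) (auto simp: power_divide)
    also have "\<dots> = 20 / N" using N by (simp add: power2_eq_square)
    also have "\<dots> \<le> 20 / sqrt N"
      using N by (intro divide_left_mono) (auto simp: real_sqrt_le_iff sqrt_le_D real_le_lsqrt power2_eq_square)
    finally show "(N + \<bar>\<phi>'' u\<bar>) / ((\<phi>' u)\<^sup>2 + N) \<le> 20 / sqrt N" .
  qed (intro integrable_continuous_interval continuous_intros)
  also have "\<dots> = 20 * (b - a) / sqrt N" using ab by simp
  finally show ?thesis
    using oscillatory_integral_bound[OF ab N0 d1 d2 cont] by (simp add: add_divide_distrib)
qed

section \<open>Fourier coefficients of an arc in the torus\<close>

definition angle1 :: "real \<Rightarrow> real" where "angle1 u = 2 * arctan u"
definition angle2 :: "real \<Rightarrow> real" where "angle2 u = 2 * arctan (u\<^sup>2)"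

text \<open>
  With \<open>z = (1 + iu) / (1 - iu)\<close> one gets \<open>u\<^sup>2 = - (1 - z)\<^sup>2 / (1 + z)\<^sup>2\<close>. Substitution into
  \<open>w (1 - iu\<^sup>2) = 1 + iu\<^sup>2\<close> and division by \<open>1 + i\<close> give the equation.
\<close>

lemma curve_relation:
  fixes u :: real
  defines "z \<equiv> cis (angle1 u)" and "w \<equiv> cis (angle2 u)"
  shows "w * z\<^sup>2 - 2 * \<i> * w * z + w + \<i> * z\<^sup>2 - 2 * z + \<i> = 0"
proof -
  have cis_arctan: "cis (2 * arctan v) * (1 - \<i> * v) = 1 + \<i> * v" for v :: real
  proof -
    have p: "1 + v\<^sup>2 > 0" by (simp add: add_pos_nonneg)
    have "cis (arctan v) = (1 + \<i> * v) / sqrt (1 + v\<^sup>2)"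
      by (simp add: complex_eq_iff cos_arctan sin_arctan)
    moreover have "(complex_of_real (sqrt (1 + v\<^sup>2)))\<^sup>2 = complex_of_real (1 + v\<^sup>2)"
      unfolding of_real_power[symmetric] using p by simp
    ultimately have "(cis (arctan v))\<^sup>2 = (1 + \<i> * v)\<^sup>2 / complex_of_real (1 + v\<^sup>2)"
      by (simp only: power_divide)
    then have "cis (2 * arctan v) = (1 + \<i> * v)\<^sup>2 / complex_of_real (1 + v\<^sup>2)"
      by (simp only: Complex.DeMoivre of_nat_numeral)
    also have "complex_of_real (1 + v\<^sup>2) = (1 + \<i> * v) * (1 - \<i> * v)"
      by (simp add: complex_eq_iff power2_eq_square)
    finally have *: "cis (2 * arctan v) = (1 + \<i> * v)\<^sup>2 / ((1 + \<i> * v) * (1 - \<i> * v))" .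
    have "1 + \<i> * v \<noteq> 0" "1 - \<i> * v \<noteq> 0" by (simp_all add: complex_eq_iff)
    then show ?thesis unfolding * by (simp add: power2_eq_square)
  qed
  define U where "U = complex_of_real u"
  have z: "z * (1 - \<i> * U) = 1 + \<i> * U"
    unfolding z_def U_def angle1_def by (rule cis_arctan)
  have w: "w * (1 - \<i> * U\<^sup>2) = 1 + \<i> * U\<^sup>2"
    unfolding w_def U_def angle2_def of_real_power[symmetric] by (rule cis_arctan)
  have nz: "1 - \<i> * U \<noteq> 0" by (simp add: complex_eq_iff U_def)
  have "(w * z\<^sup>2 - 2 * \<i> * w * z + w + \<i> * z\<^sup>2 - 2 * z + \<i>) * (1 - \<i> * U)\<^sup>2
      = w * (z * (1 - \<i> * U))\<^sup>2 - 2 * \<i> * w * (z * (1 - \<i> * U)) * (1 - \<i> * U) + w * (1 - \<i> * U)\<^sup>2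
        + \<i> * (z * (1 - \<i> * U))\<^sup>2 - 2 * (z * (1 - \<i> * U)) * (1 - \<i> * U) + \<i> * (1 - \<i> * U)\<^sup>2"
    by (simp add: algebra_simps power2_eq_square)
  also have "\<dots> = w * (1 - \<i> * U\<^sup>2) * (2 - 2 * \<i>) - (1 + \<i> * U\<^sup>2) * (2 - 2 * \<i>)"
    unfolding z by (simp add: algebra_simps power2_eq_square)
  also have "\<dots> = 0" unfolding w by simp
  finally show ?thesis using nz by simp
qed

definition curve_coeff :: "int \<times> int \<Rightarrow> complex" where
  "curve_coeff = (\<lambda>(k, m). integral {-1/2..-1/4}
     (\<lambda>u. cis (real_of_int k * angle1 u + real_of_int m * angle2 u)))"

lemma continuous_angles: "continuous_on S angle1" "continuous_on S angle2"
  unfolding angle1_def[abs_def] angle2_def[abs_def] by (intro continuous_intros)+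

lemma curve_coeff_zero: "curve_coeff (0, 0) = 1 / 4"
  by (simp add: curve_coeff_def scaleR_conv_of_real)

lemma curve_coeff_relation:
  "curve_coeff (k + 2, m + 1) + (- 2 * \<i>) * curve_coeff (k + 1, m + 1) + curve_coeff (k, m + 1)
    + \<i> * curve_coeff (k + 2, m) + (- 2) * curve_coeff (k + 1, m) + \<i> * curve_coeff (k, m) = 0"
proof -
  define g where "g = (\<lambda>(k::int, m::int) u. cis (real_of_int k * angle1 u + real_of_int m * angle2 u))"
  have hi: "(g p has_integral curve_coeff p) {-1/2..-1/4}" for p
    unfolding g_def curve_coeff_def split_beta cis_conv_exp
    by (intro integrable_integral integrable_continuous_interval continuous_intros continuous_angles)
  have shift: "g (k + a, m + b) u = g (k, m) u * (cis (angle1 u) ^ nat a * cis (angle2 u) ^ nat b)"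
    if "0 \<le> a" "0 \<le> b" for a b u
    unfolding g_def Complex.DeMoivre cis_mult prod.case by (rule arg_cong[where f = cis]) (use that in \<open>simp add: algebra_simps\<close>)
  have "g (k + 2, m + 1) u + (- 2 * \<i>) * g (k + 1, m + 1) u + g (k, m + 1) u
    + \<i> * g (k + 2, m) u + (- 2) * g (k + 1, m) u + \<i> * g (k, m) u = 0" for u
  proof -
    have "g (k + 2, m + 1) u + (- 2 * \<i>) * g (k + 1, m + 1) u + g (k, m + 1) u
      + \<i> * g (k + 2, m) u + (- 2) * g (k + 1, m) u + \<i> * g (k, m) u
      = g (k, m) u * (cis (angle2 u) * (cis (angle1 u))\<^sup>2 - 2 * \<i> * cis (angle2 u) * cis (angle1 u)
        + cis (angle2 u) + \<i> * (cis (angle1 u))\<^sup>2 - 2 * cis (angle1 u) + \<i>)"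
      using shift[of 2 1 u] shift[of 1 1 u] shift[of 0 1 u] shift[of 2 0 u] shift[of 1 0 u]
      by (simp add: algebra_simps)
    then show ?thesis unfolding curve_relation by simp
  qed
  moreover have "((\<lambda>u. g (k + 2, m + 1) u + (- 2 * \<i>) * g (k + 1, m + 1) u + g (k, m + 1) u
    + \<i> * g (k + 2, m) u + (- 2) * g (k + 1, m) u + \<i> * g (k, m) u) has_integral
    (curve_coeff (k + 2, m + 1) + (- 2 * \<i>) * curve_coeff (k + 1, m + 1) + curve_coeff (k, m + 1)
    + \<i> * curve_coeff (k + 2, m) + (- 2) * curve_coeff (k + 1, m) + \<i> * curve_coeff (k, m))) {-1/2..-1/4}"
    by (intro has_integral_add has_integral_mult_right hi)
  ultimately show ?thesis
    by (simp add: has_integral_iff)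
qed

text \<open>
  On the arc \<open>-1/2 \<le> u \<le> -1/4\<close> both angles are convex, while the first increases and the second
  decreases. Hence for the phase \<open>k angle1 + m angle2\<close> the two terms of the second derivative add up if
  \<open>k\<close> and \<open>m\<close> have the same sign, and those of the first derivative add up if they have opposite signs;
  in each case the sum is at least \<open>(\<bar>k\<bar> + \<bar>m\<bar>) / 2\<close> in absolute value. This monotonicity pattern is the
  reason for the choice of the arc.
\<close>

lemma curve_coeff_decay:
  "cmod (curve_coeff (k, m)) \<le> 22 / sqrt (1 + \<bar>real_of_int k\<bar> + \<bar>real_of_int m\<bar>)"
proof (cases "k = 0 \<and> m = 0")
  case True
  then show ?thesis by (simp add: curve_coeff_zero)
next
  case False
  define x y where "x = real_of_int k" and "y = real_of_int m"
  define N where "N = \<bar>x\<bar> + \<bar>y\<bar>"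
  have N: "1 \<le> N" using False unfolding N_def x_def y_def by linarith
  define I :: "real set" where "I = {-1/2..-1/4}"
  define a1 a2 b1 b2 :: "real \<Rightarrow> real" where "a1 u = 2 / (1 + u\<^sup>2)" and "a2 u = - 4 * u / (1 + u\<^sup>2)\<^sup>2"
    and "b1 u = 4 * u / (1 + u ^ 4)" and "b2 u = 4 * (1 - 3 * u ^ 4) / (1 + u ^ 4)\<^sup>2" for u
  have nz: "1 + u\<^sup>2 \<noteq> 0" "1 + u ^ 4 \<noteq> 0" for u :: real
    by (smt (verit) zero_le_power2, smt (verit) zero_le_even_power even_numeral)
  have d1: "((\<lambda>u. x * angle1 u + y * angle2 u) has_real_derivative x * a1 u + y * b1 u) (at u)" for u
    unfolding angle1_def angle2_def a1_def b1_def
    by (auto intro!: derivative_eq_intros simp: divide_inverse)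
  have d2: "((\<lambda>u. x * a1 u + y * b1 u) has_real_derivative x * a2 u + y * b2 u) (at u)" for u
  proof -
    have "(a1 has_real_derivative a2 u) (at u)" "(b1 has_real_derivative b2 u) (at u)"
      unfolding a1_def a2_def b1_def b2_def using nz[of u]
      by (auto intro!: derivative_eq_intros simp: power2_eq_square algebra_simps eval_nat_numeral)
    then show ?thesis by (intro DERIV_add DERIV_cmult)
  qed
  have cont: "continuous_on I (\<lambda>u. x * a2 u + y * b2 u)"
    unfolding a2_def b2_def using nz by (intro continuous_intros) auto
  have bounds: "1 / 2 \<le> a1 u" "1 / 2 \<le> a2 u" "1 / 2 \<le> - b1 u" "1 / 2 \<le> b2 u" "a2 u \<le> 4" "b2 u \<le> 4"
    if "u \<in> I" for u
  proof -
    have u: "1 / 4 \<le> - u" "- u \<le> 1 / 2" using that by (auto simp: I_def)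
    have sq: "u\<^sup>2 \<le> (1 / 2)\<^sup>2" using power_mono[of "- u" "1 / 2" 2] u by simp
    have fo: "u ^ 4 \<le> (1 / 2) ^ 4" using power_mono[of "- u" "1 / 2" 4] u by simp
    have sq0: "0 \<le> u\<^sup>2" and fo0: "0 \<le> u ^ 4" by auto
    have p2: "1 \<le> (1 + u\<^sup>2)\<^sup>2" "(1 + u\<^sup>2)\<^sup>2 \<le> (5 / 4)\<^sup>2"
      by (rule one_le_power, use sq0 in simp, rule power_mono, use sq sq0 in \<open>simp_all add: power_divide\<close>)
    have p4: "1 \<le> (1 + u ^ 4)\<^sup>2" "(1 + u ^ 4)\<^sup>2 \<le> (17 / 16)\<^sup>2"
      by (rule one_le_power, use fo0 in simp, rule power_mono, use fo fo0 in \<open>simp_all add: power_divide\<close>)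
    show "1 / 2 \<le> a1 u" unfolding a1_def using sq add_pos_nonneg[OF zero_less_one sq0] by (simp only: pos_le_divide_eq) (simp add: power_divide)
    show "1 / 2 \<le> a2 u" unfolding a2_def using p2 u by (subst pos_le_divide_eq) (auto simp: power_divide nz)
    show "1 / 2 \<le> - b1 u" unfolding b1_def minus_divide_left using fo add_pos_nonneg[OF zero_less_one fo0] u by (subst pos_le_divide_eq) (auto simp: power_divide)
    show "1 / 2 \<le> b2 u" unfolding b2_def using p4 fo by (subst pos_le_divide_eq) (auto simp: power_divide nz)
    show "a2 u \<le> 4" unfolding a2_def by (subst pos_divide_le_eq, use nz in simp, use p2 u in linarith)
    have "4 * (1 - 3 * u ^ 4) \<le> 4 * 1" using fo0 by simp
    also have "\<dots> \<le> 4 * (1 + u ^ 4)\<^sup>2" using p4(1) by (rule mult_left_mono) simp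
    finally show "b2 u \<le> 4" unfolding b2_def by (subst pos_divide_le_eq) (use nz in simp_all)
  qed
  have weighted: "N / 2 \<le> \<bar>x\<bar> * p + \<bar>y\<bar> * q" if "1 / 2 \<le> p" "1 / 2 \<le> q" for p q
    using mult_left_mono[OF that(1), of "\<bar>x\<bar>"] mult_left_mono[OF that(2), of "\<bar>y\<bar>"]
    by (simp add: N_def)
  have "cmod (integral I (\<lambda>u. cis (x * angle1 u + y * angle2 u))) \<le> 11 / sqrt N"
  proof (cases "0 \<le> x * y")
    case True
    \<comment> \<open>The common sign of the frequencies; both are zero or positive, or neither is positive.\<close>
    define \<epsilon> :: real where "\<epsilon> = (if 0 \<le> x \<and> 0 \<le> y then 1 else - 1)"
    have \<epsilon>: "\<bar>\<epsilon>\<bar> = 1" "\<epsilon> * x = \<bar>x\<bar>" "\<epsilon> * y = \<bar>y\<bar>"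
      using True by (auto simp: \<epsilon>_def zero_le_mult_iff)
    have "cmod (integral I (\<lambda>u. cis (x * angle1 u + y * angle2 u))) \<le> (1 + 3 * pi) / sqrt N"
      unfolding I_def
    proof (rule van_der_corput_curvature[OF _ _ d1 d2 cont[unfolded I_def] \<epsilon>(1)])
      fix u :: real assume "u \<in> {- 1 / 2..- 1 / 4}"
      then have "u \<in> I" by (simp add: I_def)
      then have "N / 2 \<le> \<bar>x\<bar> * a2 u + \<bar>y\<bar> * b2 u" by (intro weighted bounds)
      then show "N / 2 \<le> \<epsilon> * (x * a2 u + y * b2 u)"
        by (simp add: distrib_left mult.assoc[symmetric] \<epsilon>)
    qed (use N in auto)
    also have "\<dots> \<le> 11 / sqrt N" using N pi_less_4 pi_approx(2) by (intro divide_right_mono) auto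
    finally show ?thesis .
  next
    case False
    have "cmod (integral I (\<lambda>u. cis (x * angle1 u + y * angle2 u))) \<le> (1 + 20 * (- 1 / 4 - - 1 / 2)) / sqrt N"
      unfolding I_def
    proof (rule van_der_corput_slope[OF _ N d1 d2 cont[unfolded I_def]])
      fix u :: real assume "u \<in> {- 1 / 2..- 1 / 4}"
      then have u: "u \<in> I" by (simp add: I_def)
      have "N / 2 \<le> \<bar>x\<bar> * a1 u + \<bar>y\<bar> * - b1 u" by (intro weighted bounds u)
      also have "\<dots> \<le> \<bar>x * a1 u + y * b1 u\<bar>"
        using False by (cases "0 \<le> x") (auto simp: zero_le_mult_iff not_le)
      finally show "N / 2 \<le> \<bar>x * a1 u + y * b1 u\<bar>" .
      have "\<bar>x * a2 u\<bar> \<le> \<bar>x\<bar> * 4" "\<bar>y * b2 u\<bar> \<le> \<bar>y\<bar> * 4"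
        unfolding abs_mult using bounds[OF u] by (intro mult_left_mono; simp)+
      from order_trans[OF abs_triangle_ineq add_mono[OF this]]
      show "\<bar>x * a2 u + y * b2 u\<bar> \<le> 4 * N" by (simp add: N_def)
    qed auto
    also have "\<dots> \<le> 11 / sqrt N" using N by (intro divide_right_mono) auto
    finally show ?thesis .
  qed
  also have "11 / sqrt N \<le> 22 / sqrt (1 + N)"
  proof -
    have "sqrt (1 + N) \<le> sqrt (4 * N)" using N by simp
    also have "\<dots> = 2 * sqrt N" by (simp add: real_sqrt_mult)
    finally show ?thesis using N by (simp add: field_simps)
  qed
  finally show ?thesis by (simp add: curve_coeff_def I_def x_def y_def N_def add.assoc)
qed

text \<open>
  The exponent \<open>6\<close> suffices because \<open>(1 + \<bar>k\<bar> + \<bar>m\<bar>)\<^bsup>-3\<^esup>\<close> is at most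
  \<open>(1 + \<bar>k\<bar>)\<^bsup>-3/2\<^esup> (1 + \<bar>m\<bar>)\<^bsup>-3/2\<^esup>\<close>.
\<close>

lemma curve_coeff_summable:
  assumes "6 < p"
  shows "(\<lambda>i. cmod (curve_coeff i) powr p) summable_on UNIV"
proof -
  define h where "h k = (1 + \<bar>real_of_int k\<bar>) powr (- 3 / 2)" for k
  have nat: "summable (\<lambda>n. (1 + real n) powr (- 3 / 2))"
  proof -
    have "summable (\<lambda>n. real (Suc n) powr (- 3 / 2))"
      by (subst summable_Suc_iff[of "\<lambda>n. real n powr (- 3 / 2)"]) (simp add: summable_real_powr_iff)
    then show ?thesis by (simp add: add.commute)
  qed
  have on_nat: "(\<lambda>n. (1 + real n) powr (- 3 / 2)) summable_on UNIV"
    by (rule norm_summable_imp_summable_on) (use nat in simp)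
  have "h summable_on (range int \<union> (range (\<lambda>n. - int n) - {0}))"
  proof (rule summable_on_Un_disjoint)
    show "h summable_on range int"
      using on_nat by (subst summable_on_reindex) (auto simp: h_def o_def)
    have "h summable_on range (\<lambda>n. - int n)"
      using on_nat by (subst summable_on_reindex) (auto simp: h_def o_def inj_on_def)
    then show "h summable_on range (\<lambda>n. - int n) - {0}"
      by (rule summable_on_subset_banach) auto
  qed auto
  also have "range int \<union> (range (\<lambda>n. - int n) - {0}) = UNIV"
  proof -
    have "k \<in> range int \<union> (range (\<lambda>n. - int n) - {0})" for k by (cases k rule: int_cases3) auto
    then show ?thesis by blast
  qed
  finally have h: "h summable_on UNIV" .
  have hnn: "0 \<le> h k" for k by (simp add: h_def)
  have prod: "(\<lambda>(k, m). h k * h m) summable_on (UNIV \<times> UNIV)"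
    by (rule summable_on_SigmaI[where g = "\<lambda>k. h k * infsum h UNIV"])
      (use h hnn in \<open>auto intro!: has_sum_cmult_right summable_on_cmult_left\<close>)
  have bound: "cmod (curve_coeff i) powr p \<le> 22 powr p * (case i of (k, m) \<Rightarrow> h k * h m)" for i
  proof -
    obtain k m where i: "i = (k, m)" by (cases i)
    define X Y where "X = 1 + \<bar>real_of_int k\<bar>" and "Y = 1 + \<bar>real_of_int m\<bar>"
    have XY: "1 \<le> X" "1 \<le> Y" by (auto simp: X_def Y_def)
    define T where "T = 1 + \<bar>real_of_int k\<bar> + \<bar>real_of_int m\<bar>"
    have T: "X \<le> T" "Y \<le> T" "1 \<le> T" by (auto simp: X_def Y_def T_def)
    have "cmod (curve_coeff i) powr p \<le> (22 / sqrt T) powr p"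
      using curve_coeff_decay[of k m] assms by (intro powr_mono2) (auto simp: i T_def)
    also have "\<dots> = 22 powr p * T powr (- p / 2)"
      using T by (simp add: powr_divide powr_half_sqrt[symmetric] powr_powr powr_minus_divide)
    also have "T powr (- p / 2) \<le> T powr (- 3)"
      using T assms by (intro powr_mono) auto
    also have "T powr (- 3) = T powr (- 3 / 2) * T powr (- 3 / 2)"
      by (simp add: powr_add[symmetric])
    also have "\<dots> \<le> X powr (- 3 / 2) * Y powr (- 3 / 2)"
      using XY T by (intro mult_mono powr_mono2') auto
    finally show ?thesis by (simp add: i h_def X_def Y_def)
  qed
  have "(\<lambda>i. 22 powr p * (case i of (k, m) \<Rightarrow> h k * h m)) summable_on UNIV"
    using prod by (intro summable_on_cmult_right) simp
  then have "(\<lambda>i. norm (22 powr p * (case i of (k, m) \<Rightarrow> h k * h m))) summable_on UNIV"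
    by (rule summable_on_iff_abs_summable_on_real[THEN iffD1])
  then have "(\<lambda>i. norm (cmod (curve_coeff i) powr p)) summable_on UNIV"
  proof (rule Infinite_Sum.abs_summable_on_comparison_test)
    show "norm (cmod (curve_coeff i) powr p) \<le> norm (22 powr p * (case i of (k, m) \<Rightarrow> h k * h m))" for i
      unfolding real_norm_def using bound[of i] powr_ge_zero[of "cmod (curve_coeff i)" p] by linarith
  qed
  then show ?thesis by simp
qed

section \<open>Quantum translates of diagonal operators\<close>

lemma has_sum_sum:
  fixes f :: "'j \<Rightarrow> 'i \<Rightarrow> 'b::topological_comm_monoid_add"
  assumes "finite J" "\<And>j. j \<in> J \<Longrightarrow> (f j has_sum s j) A"
  shows "((\<lambda>i. \<Sum>j\<in>J. f j i) has_sum (\<Sum>j\<in>J. s j)) A"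
  using assms by (induction rule: finite_induct) (auto intro: has_sum_add)

text \<open>
  Conjugation by a unitary operator that permutes the orthonormal family transports the diagonal entries
  along the permutation.
\<close>

lemma quantum_translate_diag:
  fixes e :: "'i::{countable, ab_group_add} \<Rightarrow> 'a::euclidean_space L2"
  assumes "riesz_fischer_family e" and bounded: "\<And>i. cmod (\<gamma> i) \<le> K"
    and shift: "\<And>i. rho x 0 (e i) = e (i + a)"
  shows "((\<lambda>i. (\<gamma> (i - a) * cinner \<phi> (e i)) *\<^sub>C e i) has_sum
    quantum_translate (x, 0) (riesz_fischer_family.diag e \<gamma>) \<phi>) UNIV"
proof -
  interpret riesz_fischer_family e by fact
  have "cinner (rho (- x) (- 0) \<phi>) (e i) = cinner \<phi> (e (i + a))" for i
    using cinner_rho[of x 0 "rho (- x) (- 0) \<phi>" "e i"] by (simp only: rho_rho_minus shift)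
  then have "((\<lambda>i. (\<gamma> i * cinner \<phi> (e (i + a))) *\<^sub>C e i) has_sum diag \<gamma> (rho (- x) (- 0) \<phi>)) UNIV"
    using has_sum_diag[of \<gamma> K "rho (- x) (- 0) \<phi>"] bounded by simp
  from has_sum_bounded_linear[OF bounded_linear_rho this, of x 0]
  have "((\<lambda>i. (\<gamma> i * cinner \<phi> (e (i + a))) *\<^sub>C e (i + a)) has_sum rho x 0 (diag \<gamma> (rho (- x) (- 0) \<phi>))) UNIV"
    by (simp only: rho_scaleC shift)
  then have "((\<lambda>i. (\<gamma> (i - a) * cinner \<phi> (e i)) *\<^sub>C e i) has_sum rho x 0 (diag \<gamma> (rho (- x) (- 0) \<phi>))) UNIV"
    by (rule has_sum_reindex_bij_witness[where i = "\<lambda>i. i - a" and j = "\<lambda>i. i + a", THEN iffD1, rotated -1]) auto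
  then show ?thesis by (simp add: quantum_translate_def inv_rho)
qed

definition lattice_point :: "'a \<Rightarrow> 'a \<Rightarrow> int \<times> int \<Rightarrow> 'a::euclidean_space" where
  "lattice_point v w i = real_of_int (fst i) *\<^sub>R v + real_of_int (snd i) *\<^sub>R w"

lemma lattice_point_add: "lattice_point v w (i + j) = lattice_point v w i + lattice_point v w j"
  by (simp add: lattice_point_def scaleR_add_left)

lemma lattice_point_inner:
  assumes "v \<in> Basis" "w \<in> Basis" "v \<noteq> w"
  shows "lattice_point v w i \<bullet> v = fst i" "lattice_point v w i \<bullet> w = snd i"
  using assms by (simp_all add: lattice_point_def inner_add_left inner_Basis)

definition cube_function :: "'a \<Rightarrow> 'a::euclidean_space \<Rightarrow> complex" where
  "cube_function x t = indicator (box 0 One) (t + x)"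

lemma square_integrable_cube_function: "square_integrable (cube_function x)"
proof -
  have "square_integrable (indicator (box 0 One) :: 'a \<Rightarrow> complex)"
  proof -
    have "(\<lambda>t. (cmod (indicator (box 0 One) t))\<^sup>2) = (indicator (box 0 (One::'a)) :: 'a \<Rightarrow> real)"
      by (auto simp: indicator_def)
    then show ?thesis by (simp add: square_integrable_def)
  qed
  then show ?thesis
    using square_integrable_translate[of "indicator (box 0 One)" x] by (simp add: cube_function_def[abs_def])
qed

lemma norm_cube_function: "(LINT t|lborel. (cmod (cube_function x t))\<^sup>2) = 1"
proof -
  have "t + x \<in> box 0 One \<longleftrightarrow> t \<in> box (- x) (One - x)" for t
    unfolding mem_box by (rule ball_cong[OF refl]) (auto simp: inner_diff_left inner_add_left)
  then have eq: "(cmod (cube_function x t))\<^sup>2 = indicator (box (- x) (One - x)) t" for t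
    by (simp add: cube_function_def indicator_def)
  have "measure lborel (box (- x) (One - x)) = 1"
    by (simp add: measure_def emeasure_lborel_box_eq inner_diff_left)
  then show ?thesis unfolding eq by simp
qed

lemma disjoint_cube_functions:
  assumes vw: "v \<in> Basis" "w \<in> Basis" "v \<noteq> w"
  shows "disjoint_functions (\<lambda>i. cube_function (lattice_point v w i)) (\<lambda>t. (- \<lfloor>t \<bullet> v\<rfloor>, - \<lfloor>t \<bullet> w\<rfloor>))"
proof
  show "(\<lambda>t. (- \<lfloor>t \<bullet> v\<rfloor>, - \<lfloor>t \<bullet> w\<rfloor>)) \<in> borel \<rightarrow>\<^sub>M count_space UNIV"
    by measurable
  fix i t
  assume "cube_function (lattice_point v w i) t \<noteq> 0"
  then have "t + lattice_point v w i \<in> box 0 One"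
    by (auto simp: cube_function_def indicator_def split: if_splits)
  then have "0 < (t + lattice_point v w i) \<bullet> b \<and> (t + lattice_point v w i) \<bullet> b < 1" if "b \<in> Basis" for b
    using that by (simp add: mem_box)
  from this[OF vw(1)] this[OF vw(2)]
  have "\<lfloor>t \<bullet> v\<rfloor> = - fst i" "\<lfloor>t \<bullet> w\<rfloor> = - snd i"
    by (auto simp: inner_add_left lattice_point_inner[OF vw] floor_eq_iff)
  then show "(- \<lfloor>t \<bullet> v\<rfloor>, - \<lfloor>t \<bullet> w\<rfloor>) = i" by simp
qed (rule square_integrable_cube_function norm_cube_function)+

lemma rho_cube_function: "rho x 0 (abs_L2 (cube_function y)) = abs_L2 (cube_function (y + x))"
  using square_integrable_cube_function[of y]
  by (simp add: rho.abs_eq L2_rel_def) (simp add: cube_function_def[abs_def] ac_simps)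

text \<open>
  The exponents of \<open>(z, w)\<close> and the coefficients of the six monomials in the equation of the curve.
\<close>

definition shifts :: "(int \<times> int) list" where
  "shifts = [(2, 1), (1, 1), (0, 1), (2, 0), (1, 0), (0, 0)]"

definition scalars :: "complex list" where
  "scalars = [1, - 2 * \<i>, 1, \<i>, - 2, \<i>]"

theorem mainTheorem2:
  fixes p :: real
  assumes "CARD('n::finite) \<ge> 6"
    and "p > real CARD('n)"
  shows "\<exists>A :: (real ^ 'n) L2 \<Rightarrow> (real ^ 'n) L2.
           A \<in> schatten_class p \<and> A \<noteq> (\<lambda>\<phi>. 0) \<and>
           (\<exists>(k::nat) (z :: nat \<Rightarrow> (real ^ 'n) \<times> (real ^ 'n)) (c :: nat \<Rightarrow> complex).
              k > 0 \<and> inj_on z {1..k} \<and> (\<exists>j\<in>{1..k}. c j \<noteq> 0) \<and>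
              (\<lambda>\<phi>. \<Sum>j=1..k. c j *\<^sub>C quantum_translate (z j) A \<phi>) = (\<lambda>\<phi>. 0))"
proof -
  have p: "6 < p" using assms by linarith
  obtain v w :: "real ^ 'n" where vw: "v \<in> Basis" "w \<in> Basis" "v \<noteq> w"
  proof -
    have "2 \<le> card (Basis :: (real ^ 'n) set)" using assms(1) by simp
    then show ?thesis using that by (meson card_2_iff' obtain_subset_with_card_n subsetD)
  qed
  interpret disjoint_functions "\<lambda>i. cube_function (lattice_point v w i)" "\<lambda>t. (- \<lfloor>t \<bullet> v\<rfloor>, - \<lfloor>t \<bullet> w\<rfloor>)"
    using vw by (rule disjoint_cube_functions)
  let ?e = "\<lambda>i. abs_L2 (cube_function (lattice_point v w i))"
  let ?A = "diag curve_coeff"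
  have bounded: "cmod (curve_coeff i) \<le> 22" for i
  proof -
    obtain k m where i: "i = (k, m)" by (cases i)
    have "22 / sqrt (1 + \<bar>real_of_int k\<bar> + \<bar>real_of_int m\<bar>) \<le> 22 / 1"
      by (intro divide_left_mono) auto
    then show ?thesis using curve_coeff_decay[of k m] by (simp add: i)
  qed
  have "?A \<in> schatten_class p"
    using p by (intro diag_in_schatten_class curve_coeff_summable) auto
  moreover have "?A \<noteq> (\<lambda>\<phi>. 0)"
  proof
    assume "?A = (\<lambda>\<phi>. 0)"
    then have "cinner (0 :: (real ^ 'n) L2) (?e (0, 0)) = curve_coeff (0, 0) * cinner (?e (0, 0)) (?e (0, 0))"
      using cinner_diag[of curve_coeff, OF bounded, where \<phi> = "?e (0, 0)" and j = "(0, 0)"] by simp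
    then show False
      using cinner_scaleC_left[of 0 0 "?e (0, 0)"] by (simp add: orthonormal curve_coeff_zero)
  qed
  \<comment> \<open>The translate by \<open>- a\<close> shifts the diagonal by \<open>- a\<close>, so that its entry at \<open>i\<close> is the coefficient at \<open>i + a\<close>.\<close>
  moreover define z where "z j = (lattice_point v w (- shifts ! (j - 1)), 0 :: real ^ 'n)" for j :: nat
  define c where "c j = scalars ! (j - 1)" for j :: nat
  have "inj_on z {1..6}"
  proof (rule inj_onI)
    fix j k assume jk: "j \<in> {1..6}" "k \<in> {1..6}" "z j = z k"
    then have "lattice_point v w (- shifts ! (j - 1)) = lattice_point v w (- shifts ! (k - 1))"
      by (simp add: z_def)
    then have "- shifts ! (j - 1) = - shifts ! (k - 1)"
      using lattice_point_inner[OF vw] by (metis of_int_eq_iff prod_eq_iff)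
    moreover have "distinct shifts" "length shifts = 6" by (simp_all add: shifts_def)
    ultimately have "j - 1 = k - 1" using jk by (subst nth_eq_iff_index_eq[symmetric]) auto
    then show "j = k" using jk by auto
  qed
  moreover have "c 1 \<noteq> 0" by (simp add: c_def scalars_def)
  moreover have "(\<Sum>j=1..6. c j *\<^sub>C quantum_translate (z j) ?A \<phi>) = 0" for \<phi>
  proof (rule has_sum_unique)
    have shift: "rho (lattice_point v w a) 0 (?e i) = ?e (i + a)" for a i
      by (simp add: rho_cube_function lattice_point_add)
    have "((\<lambda>i. (curve_coeff (i - - shifts ! (j - 1)) * cinner \<phi> (?e i)) *\<^sub>C ?e i) has_sum
        quantum_translate (z j) ?A \<phi>) UNIV" for j
      unfolding z_def by (rule quantum_translate_diag[OF riesz_fischer_family_axioms bounded shift])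
    then show "((\<lambda>i. \<Sum>j=1..6. c j *\<^sub>C (curve_coeff (i - - shifts ! (j - 1)) * cinner \<phi> (?e i)) *\<^sub>C ?e i) has_sum
        (\<Sum>j=1..6. c j *\<^sub>C quantum_translate (z j) ?A \<phi>)) UNIV"
      by (intro has_sum_sum has_sum_bounded_linear[OF bounded_linear_scaleC_right]) auto
    have "(\<Sum>j=1..6. c j *\<^sub>C (curve_coeff (i - - shifts ! (j - 1)) * cinner \<phi> (?e i)) *\<^sub>C ?e i) = 0" for i
    proof -
      obtain k m where i: "i = (k, m)" by (cases i)
      have "{1..6::nat} = {1, 2, 3, 4, 5, 6}" by auto
      then have "(\<Sum>j=1..6. c j * curve_coeff (i - - shifts ! (j - 1))) = 0"
        using curve_coeff_relation[of k m] by (simp add: i c_def shifts_def scalars_def algebra_simps)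
      moreover have "(\<Sum>j=1..6. c j *\<^sub>C (curve_coeff (i - - shifts ! (j - 1)) * cinner \<phi> (?e i)) *\<^sub>C ?e i)
          = ((\<Sum>j=1..6. c j * curve_coeff (i - - shifts ! (j - 1))) * cinner \<phi> (?e i)) *\<^sub>C ?e i"
        by (simp add: sum_distrib_right L2.scale_sum_left mult.assoc)
      ultimately show ?thesis by simp
    qed
    then show "((\<lambda>i. \<Sum>j=1..6. c j *\<^sub>C (curve_coeff (i - - shifts ! (j - 1)) * cinner \<phi> (?e i)) *\<^sub>C ?e i) has_sum 0) UNIV"
      by simp
  qed
  ultimately show ?thesis
    by (intro exI[of _ ?A] exI[of _ 6] exI[of _ z] exI[of _ c] conjI bexI[of _ 1]) auto
qed

end
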